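(* Let $\nu(|V|)=\nu_0|V|^k$ with $\nu_0>0$ constant and $k=2m$, $m\in\mathbb N$. Suppose that the solution $(V,E)$ of the system $$\frac{\partial V}{\partial t}+V\frac{\partial V}{\partial x}=-E-\nu(|V|)V,\qquad \frac{\partial E}{\partial t}+V\frac{\partial E}{\partial x}-V=0$$ with initial data $(V,E)|_{t=0}=(V_0(x),E_0(x))\in C^2(\mathbb R)$ exists (as a smooth solution) for all $t\ge0$. Then along any characteristic $x=x(t)$ the following asymptotics takes place: $$V(x(t))\sim t^{-\frac1k}\sum_{n=0}^\infty\Psi_n(t)\,t^{-n},\qquad t\to\infty,$$ where the functions $\Psi_n$ are periodic.
   Context: A characteristic is a curve $x(t)$ with $\dot x=V(x(t),t)$, $x(0)=x_0\in\mathbb R$; $V(x(t))$ denotes $V(x(t),t)$. Along it $\dot V=-E-\nu(|V|)V$, $\dot E=V$. The relation $\sim$ is understood as an asymptotic expansion: for each $N\ge 0$, $V(x(t))-t^{-1/k}\sum_{n=0}^N\Psi_n(t)t^{-n}=o(t^{-1/k-N})$ as $t\to\infty$. It is assumed throughout that $E_x<1$ initially (positivity of the density $1-E_x$). *)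

theory Defs
  imports
    "HOL-Analysis.Analysis"
    "HOL-Library.Landau_Symbols"
    "HOL-Library.Periodic_Fun"
begin

definition C2_on_real :: "(real \<Rightarrow> real) \<Rightarrow> bool" where
  "C2_on_real f \<longleftrightarrow> f C1_differentiable_on UNIV \<and> deriv f C1_differentiable_on UNIV"

text \<open>
  \<open>U x t\<close> is of class \<open>C\<^sup>1\<close> on the closed half plane \<open>t \<ge> 0\<close>, with partial
  derivatives \<open>Ux\<close> and \<open>Ut\<close>; on the boundary line \<open>t = 0\<close> the derivative in time is one-sided.
\<close>
definition has_C1_partials ::
    "(real \<Rightarrow> real \<Rightarrow> real) \<Rightarrow> (real \<Rightarrow> real \<Rightarrow> real) \<Rightarrow> (real \<Rightarrow> real \<Rightarrow> real) \<Rightarrow> bool" where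
  "has_C1_partials U Ux Ut \<longleftrightarrow>
     (\<forall>x. \<forall>t\<ge>0. ((\<lambda>y. U y t) has_real_derivative Ux x t) (at x) \<and>
                ((\<lambda>s. U x s) has_real_derivative Ut x t) (at t within {0..})) \<and>
     continuous_on (UNIV \<times> {0..}) (\<lambda>(x, t). Ux x t) \<and>
     continuous_on (UNIV \<times> {0..}) (\<lambda>(x, t). Ut x t)"

text \<open>
  Values at negative times are irrelevant.  Class \<open>C\<^sup>1\<close> is the least
  regularity of a classical solution, so solutions of higher smoothness are covered as well.
\<close>
definition global_smooth_solution ::
    "(real \<Rightarrow> real) \<Rightarrow> (real \<Rightarrow> real) \<Rightarrow> (real \<Rightarrow> real) \<Rightarrow>
     (real \<Rightarrow> real \<Rightarrow> real) \<Rightarrow> (real \<Rightarrow> real \<Rightarrow> real) \<Rightarrow> bool" where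
  "global_smooth_solution \<nu> V0 E0 V E \<longleftrightarrow>
     (\<exists>Vx Vt Ex Et.
        has_C1_partials V Vx Vt \<and> has_C1_partials E Ex Et \<and>
        (\<forall>x. \<forall>t\<ge>0. Vt x t + V x t * Vx x t = - E x t - \<nu> \<bar>V x t\<bar> * V x t \<and>
                   Et x t + V x t * Ex x t - V x t = 0)) \<and>
     (\<forall>x. V x 0 = V0 x \<and> E x 0 = E0 x)"

definition characteristic :: "(real \<Rightarrow> real \<Rightarrow> real) \<Rightarrow> real \<Rightarrow> (real \<Rightarrow> real) \<Rightarrow> bool" where
  "characteristic V x0 X \<longleftrightarrow>
     X 0 = x0 \<and> (\<forall>t\<ge>0. (X has_real_derivative V (X t) t) (at t within {0..}))"

definition periodic_real :: "(real \<Rightarrow> real) \<Rightarrow> bool" where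
  "periodic_real f \<longleftrightarrow> (\<exists>T>0. periodic_fun_simple f T)"

text \<open>
  \<open>f(t) \<sim> t\<^sup>a \<Sum>\<^sub>n \<Psi>\<^sub>n(t) t\<^sup>-\<^sup>n\<close> as \<open>t \<rightarrow> \<infinity>\<close>, as an asymptotic
  expansion; the series is not claimed to converge.
\<close>
definition asymp_expansion :: "(real \<Rightarrow> real) \<Rightarrow> real \<Rightarrow> (nat \<Rightarrow> real \<Rightarrow> real) \<Rightarrow> bool" where
  "asymp_expansion f a \<Psi> \<longleftrightarrow>
     (\<forall>N. (\<lambda>t. f t - t powr a * (\<Sum>n=0..N. \<Psi> n t * t powr (- real n)))
            \<in> o[at_top](\<lambda>t. t powr (a - real N)))"

end

theory Submission
  imports Defs
begin

text \<open>
  Along a characteristic the equations become the damped oscillator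
  \<open>V' = - E - \<nu>\<^sub>0 V\<^sup>k\<^sup>+\<^sup>1\<close>, \<open>E' = V\<close>.  In polar form \<open>E = R cos \<theta>\<close>, \<open>V = - R sin \<theta>\<close>, and with
  \<open>u = R\<^sup>-\<^sup>k\<close>, it reads
  \<open>u' = k \<nu>\<^sub>0 (sin \<theta>)\<^sup>k\<^sup>+\<^sup>2\<close>, \<open>\<theta>' = 1 - (\<nu>\<^sub>0 / u) cos \<theta> (sin \<theta>)\<^sup>k\<^sup>+\<^sup>1\<close>.
  So \<open>u\<close> grows on average at the constant rate \<open>a = k \<nu>\<^sub>0 \<langle>sin\<^sup>k\<^sup>+\<^sup>2\<rangle>\<close>, hence \<open>R\<close> decays like \<open>t\<close> to the
  power \<open>- 1 / k\<close>, while the phase advances like \<open>t\<close> up to terms of order \<open>1 / u\<close>.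

  An expansion in integer powers of \<open>1 / t\<close> requires that no logarithm appear, that is, that the
  equations for the averaged variables contain no \<open>1 / t\<close> term.  What excludes it is that the \<open>1 / u\<close>
  terms are \<open>cos \<theta>\<close> times polynomials in \<open>sin \<theta>\<close> (polynomials because \<open>k\<close> is even): they are derivatives of
  polynomials in \<open>sin \<theta>\<close>, hence of mean zero,
  and can be removed by an explicit periodic change of variables.  The corrected
  quantities \<open>w_corr\<close>, \<open>A_corr\<close> and \<open>B_corr\<close> below satisfy equations whose right-hand sides are
  trigonometric polynomials in \<open>\<theta>\<close> and \<open>t\<close> divided by \<open>u\<^sup>2\<close>.

  The expansion follows by bootstrapping.  Let \<open>expandable N\<close> be the ring of functions that have an
  expansion with \<open>2\<pi>\<close>-periodic coefficients and error \<open>O(t\<^sup>-\<^sup>N)\<close>.  If \<open>f' = h / t\<^sup>2\<close> with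
  \<open>h\<close> expandable to order \<open>N\<close>, then \<open>f\<close> is expandable to order \<open>N + 1\<close> (lemma
  \<open>expandable_antiderivative\<close>).  Hence expansions to order \<open>N\<close> of the rotated phase
  \<open>(cos (\<theta> - t), sin (\<theta> - t))\<close>, of \<open>u - a t\<close> and of \<open>t / u\<close> give expansions of the corrected variables to order
  \<open>N + 1\<close>, and undoing the corrections preserves this order (lemma \<open>expandable_step\<close>).  The induction starts from boundedness, which rests on an
  a priori linear lower bound for \<open>u\<close> (lemma \<open>linear_growth\<close>).  Taking a \<open>k\<close>-th root recovers
  \<open>R\<close>, and uniqueness of the coefficients makes one sequence \<open>\<Psi>\<close> serve all orders.
\<close>

section \<open>Expansions in powers of 1/t with periodic coefficients\<close>

definition periodic_coeff :: "(real \<Rightarrow> real) \<Rightarrow> bool" where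
  "periodic_coeff p \<longleftrightarrow> continuous_on UNIV p \<and> (\<forall>t. p (t + 2 * pi) = p t)"

text \<open>
  The recursion peels off the leading coefficient, so that products, antiderivatives and
  remainders can be treated by induction on the order without manipulating finite sums.
\<close>

primrec expandable :: "nat \<Rightarrow> (real \<Rightarrow> real) \<Rightarrow> bool" where
  "expandable 0 g \<longleftrightarrow> (\<exists>K. \<forall>\<^sub>F t in at_top. \<bar>g t\<bar> \<le> K)"
| "expandable (Suc N) g \<longleftrightarrow>
     (\<exists>p h. periodic_coeff p \<and> expandable N h \<and> (\<forall>\<^sub>F t in at_top. g t = p t + h t / t))"

lemma periodic_coeff_const: "periodic_coeff (\<lambda>t. c)"
  by (simp add: periodic_coeff_def)

lemma periodic_coeff_sin: "periodic_coeff sin"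
  and periodic_coeff_cos: "periodic_coeff cos"
  by (auto simp: periodic_coeff_def intro!: continuous_intros)

lemma periodic_coeff_add:
  "periodic_coeff p \<Longrightarrow> periodic_coeff q \<Longrightarrow> periodic_coeff (\<lambda>t. p t + q t)"
  and periodic_coeff_mult:
  "periodic_coeff p \<Longrightarrow> periodic_coeff q \<Longrightarrow> periodic_coeff (\<lambda>t. p t * q t)"
  by (auto simp: periodic_coeff_def intro!: continuous_intros)

lemma periodic_int_shift:
  assumes "\<And>t. p (t + 2 * pi) = p t"
  shows "p (t + real n * (2 * pi)) = p t"
proof (induction n)
  case (Suc n)
  have "p (t + real (Suc n) * (2 * pi)) = p ((t + real n * (2 * pi)) + 2 * pi)"
    by (simp add: algebra_simps)
  then show ?case using Suc assms by simp
qed simp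

text \<open>
  This is the source of the uniqueness of expansion coefficients: along \<open>t + 2 \<pi> n\<close> a periodic
  function is constant.
\<close>

lemma periodic_coeff_tendsto_0:
  assumes "periodic_coeff p" "(p \<longlongrightarrow> 0) at_top"
  shows "p t = 0"
proof -
  have "filterlim (\<lambda>n. t + real n * (2 * pi)) at_top sequentially"
    by (intro filterlim_tendsto_add_at_top[OF tendsto_const]
              filterlim_at_top_mult_tendsto_pos[OF tendsto_const] filterlim_real_sequentially) simp
  then have "(\<lambda>n. p (t + real n * (2 * pi))) \<longlonglongrightarrow> 0"
    by (rule filterlim_compose[OF assms(2)])
  moreover have "\<And>n. p (t + real n * (2 * pi)) = p t"
    using assms(1) by (intro periodic_int_shift) (auto simp: periodic_coeff_def)
  ultimately show ?thesis by (simp add: LIMSEQ_const_iff)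
qed

lemma periodic_coeff_bounded:
  assumes "periodic_coeff p"
  shows "\<exists>K. \<forall>\<^sub>F t in at_top. \<bar>p t\<bar> \<le> K"
proof -
  have "compact (p ` {0..2*pi})"
    using assms by (intro compact_continuous_image)
      (auto simp: periodic_coeff_def intro: continuous_on_subset)
  then obtain K where K: "\<And>t. t \<in> {0..2*pi} \<Longrightarrow> \<bar>p t\<bar> \<le> K"
    by (force simp: bounded_iff dest!: compact_imp_bounded)
  have "\<bar>p t\<bar> \<le> K" if "t \<ge> 0" for t
  proof -
    define n where "n = nat \<lfloor>t / (2 * pi)\<rfloor>"
    have n: "real n = of_int \<lfloor>t / (2 * pi)\<rfloor>" using that by (simp add: n_def)
    have "of_int \<lfloor>t / (2 * pi)\<rfloor> \<le> t / (2 * pi)" "t / (2 * pi) \<le> of_int \<lfloor>t / (2 * pi)\<rfloor> + 1"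
      by linarith+
    then have "real n * (2 * pi) \<le> t" "t \<le> (real n + 1) * (2 * pi)"
      unfolding n
      by (auto intro: pos_le_divide_eq[THEN iffD1, rotated] pos_divide_le_eq[THEN iffD1, rotated])
    then have "t - real n * (2 * pi) \<in> {0..2*pi}" by (auto simp: algebra_simps)
    then have "\<bar>p (t - real n * (2 * pi))\<bar> \<le> K" by (rule K)
    moreover have "p ((t - real n * (2 * pi)) + real n * (2 * pi)) = p (t - real n * (2 * pi))"
      using assms by (intro periodic_int_shift) (auto simp: periodic_coeff_def)
    ultimately show ?thesis by simp
  qed
  then show ?thesis by (meson eventually_at_top_linorder)
qed

text \<open>
  Subtracting the mean leaves an integrand whose integral over one period vanishes, so its
  primitive is again periodic.
\<close>

lemma periodic_coeff_antiderivative: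
  assumes "periodic_coeff p"
  obtains \<mu> P where "periodic_coeff P" "\<And>t. (P has_real_derivative (p t - \<mu>)) (at t)"
proof -
  have c: "\<And>x. isCont p x" using assms by (simp add: periodic_coeff_def continuous_on_eq_continuous_at)
  obtain F where F: "\<And>x. (F has_vector_derivative p x) (at x)"
    using einterval_antiderivative[of "-\<infinity>" "\<infinity>" p] c by auto
  have F: "(F has_real_derivative p x) (at x)" for x
    using F by (simp add: has_real_derivative_iff_has_vector_derivative)
  define \<mu> where "\<mu> = (F (2 * pi) - F 0) / (2 * pi)"
  define P where "P = (\<lambda>t. F t - \<mu> * t)"
  have der: "(P has_real_derivative (p t - \<mu>)) (at t)" for t
    unfolding P_def by (auto intro!: derivative_eq_intros F)
  have "((\<lambda>t. F (t + 2 * pi) - F t) has_real_derivative 0) (at t)" for t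
  proof -
    have "((\<lambda>t. F (t + 2 * pi)) has_real_derivative p (t + 2 * pi)) (at t)"
      using F[of "t + 2*pi"] by (simp add: DERIV_shift)
    from DERIV_diff[OF this F[of t]] show ?thesis using assms by (simp add: periodic_coeff_def)
  qed
  then have step: "F (t + 2 * pi) - F t = F (0 + 2 * pi) - F 0" for t
    by (intro DERIV_isconst_all[of "\<lambda>t. F (t + 2 * pi) - F t" t 0]) blast
  then have per: "P (t + 2 * pi) = P t" for t
  proof -
    have "P (t + 2 * pi) = F (t + 2 * pi) - (\<mu> * t + \<mu> * (2 * pi))"
      by (simp only: P_def distrib_left)
    also have "\<mu> * (2 * pi) = F (2 * pi) - F 0" by (simp add: \<mu>_def)
    also have "F (t + 2 * pi) - (\<mu> * t + (F (2 * pi) - F 0)) = P t"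
      using step[of t] by (simp add: P_def algebra_simps)
    finally show ?thesis .
  qed
  have "continuous_on UNIV P"
    by (meson DERIV_isCont continuous_at_imp_continuous_on der)
  with per der that show ?thesis by (auto simp: periodic_coeff_def)
qed

lemma expandable_cong:
  assumes "\<forall>\<^sub>F t in at_top. f t = g t" "expandable N g"
  shows "expandable N f"
proof (cases N)
  case 0
  with assms obtain K where "\<forall>\<^sub>F t in at_top. \<bar>g t\<bar> \<le> K" by auto
  with assms(1) have "\<forall>\<^sub>F t in at_top. \<bar>f t\<bar> \<le> K" by eventually_elim simp
  with 0 show ?thesis by auto
next
  case (Suc M)
  with assms obtain p h where "periodic_coeff p" "expandable M h"
    "\<forall>\<^sub>F t in at_top. g t = p t + h t / t" by auto
  moreover from assms(1) this(3) have "\<forall>\<^sub>F t in at_top. f t = p t + h t / t"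
    by eventually_elim simp
  ultimately show ?thesis using Suc by auto
qed

lemma expandable_0D: "expandable 0 g \<Longrightarrow> (\<And>K. K > 0 \<Longrightarrow> \<forall>\<^sub>F t in at_top. \<bar>g t\<bar> \<le> K \<Longrightarrow> thesis) \<Longrightarrow> thesis"
proof -
  assume "expandable 0 g" and *: "\<And>K. K > 0 \<Longrightarrow> \<forall>\<^sub>F t in at_top. \<bar>g t\<bar> \<le> K \<Longrightarrow> thesis"
  then obtain K where "\<forall>\<^sub>F t in at_top. \<bar>g t\<bar> \<le> K" by auto
  then have "\<forall>\<^sub>F t in at_top. \<bar>g t\<bar> \<le> \<bar>K\<bar> + 1" by eventually_elim auto
  then show thesis by (intro *[of "\<bar>K\<bar> + 1"]) auto
qed

lemma expandable_0_add: "expandable 0 f \<Longrightarrow> expandable 0 g \<Longrightarrow> expandable 0 (\<lambda>t. f t + g t)"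
proof -
  assume "expandable 0 f" "expandable 0 g"
  then obtain K L where "\<forall>\<^sub>F t in at_top. \<bar>f t\<bar> \<le> K" "\<forall>\<^sub>F t in at_top. \<bar>g t\<bar> \<le> L" by auto
  then have "\<forall>\<^sub>F t in at_top. \<bar>f t + g t\<bar> \<le> K + L" by eventually_elim auto
  then show ?thesis by auto
qed

lemma expandable_0_mult: "expandable 0 f \<Longrightarrow> expandable 0 g \<Longrightarrow> expandable 0 (\<lambda>t. f t * g t)"
proof -
  assume "expandable 0 f" "expandable 0 g"
  then obtain K L where "K > 0" "\<forall>\<^sub>F t in at_top. \<bar>f t\<bar> \<le> K" "\<forall>\<^sub>F t in at_top. \<bar>g t\<bar> \<le> L"
    by (metis expandable_0D)
  from this(2,3) have "\<forall>\<^sub>F t in at_top. \<bar>f t * g t\<bar> \<le> K * L"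
  proof eventually_elim
    case (elim t)
    with \<open>K > 0\<close> show ?case by (auto simp: abs_mult intro!: mult_mono)
  qed
  then show ?thesis by auto
qed

lemma expandable_0_div: "expandable 0 f \<Longrightarrow> expandable 0 (\<lambda>t. f t / t)"
proof -
  assume "expandable 0 f"
  then obtain K where "\<forall>\<^sub>F t in at_top. \<bar>f t\<bar> \<le> K" by auto
  then have "\<forall>\<^sub>F t in at_top. \<bar>f t / t\<bar> \<le> K" using eventually_ge_at_top[of 1]
  proof eventually_elim
    case (elim t)
    then have "\<bar>f t\<bar> / t \<le> \<bar>f t\<bar>"
      using divide_left_mono[of 1 t "\<bar>f t\<bar>"] by simp
    with elim show ?case by simp
  qed
  then show ?thesis by auto
qed

lemma expandable_Suc_imp: "expandable (Suc N) g \<Longrightarrow> expandable N g"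
proof (induction N arbitrary: g)
  case 0
  then obtain p h where ph: "periodic_coeff p" "expandable 0 h" "\<forall>\<^sub>F t in at_top. g t = p t + h t / t"
    by auto
  then have "expandable 0 p" using periodic_coeff_bounded by simp
  from expandable_cong[OF ph(3) expandable_0_add[OF this expandable_0_div[OF ph(2)]]]
  show ?case .
next
  case (Suc N)
  from Suc.prems obtain p h where "periodic_coeff p" "expandable (Suc N) h"
    "\<forall>\<^sub>F t in at_top. g t = p t + h t / t"
    by (auto simp: expandable.simps(2)[of "Suc N"] simp del: expandable.simps(2))
  then show ?case using Suc.IH[of h] by auto
qed

lemma expandable_mono: "M \<le> N \<Longrightarrow> expandable N g \<Longrightarrow> expandable M g"
  by (induction N) (auto simp: le_Suc_eq dest: expandable_Suc_imp simp del: expandable.simps)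

lemma expandable_div: "expandable N g \<Longrightarrow> expandable (Suc N) (\<lambda>t. g t / t)"
  using periodic_coeff_const[of 0] by force

lemma expandable_0: "expandable N (\<lambda>t. 0)"
proof (induction N)
  case (Suc N)
  then show ?case using expandable_div[OF Suc] by (simp del: expandable.simps)
qed auto

lemma expandable_periodic: "periodic_coeff p \<Longrightarrow> expandable N p"
  using periodic_coeff_bounded[of p] expandable_0 by (cases N) force+

lemma expandable_const: "expandable N (\<lambda>t. c)"
  by (intro expandable_periodic periodic_coeff_const)

lemma expandable_add: "expandable N f \<Longrightarrow> expandable N g \<Longrightarrow> expandable N (\<lambda>t. f t + g t)"
proof (induction N arbitrary: f g)
  case 0 then show ?case by (rule expandable_0_add)
next
  case (Suc N)
  from Suc.prems obtain p h q l where "periodic_coeff p" "periodic_coeff q"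
    and hl: "expandable N h" "expandable N l" and
    "\<forall>\<^sub>F t in at_top. f t = p t + h t / t" "\<forall>\<^sub>F t in at_top. g t = q t + l t / t"
    by auto
  moreover from this(5,6) have "\<forall>\<^sub>F t in at_top. f t + g t = (p t + q t) + (h t + l t) / t"
    by eventually_elim (simp add: add_divide_distrib)
  moreover have "expandable N (\<lambda>t. h t + l t)" using Suc.IH hl .
  ultimately show ?case using periodic_coeff_add by auto
qed

lemma expandable_mult: "expandable N f \<Longrightarrow> expandable N g \<Longrightarrow> expandable N (\<lambda>t. f t * g t)"
proof (induction N arbitrary: f g)
  case 0 then show ?case by (rule expandable_0_mult)
next
  case (Suc N)
  from Suc.prems obtain p h q l where p: "periodic_coeff p" "periodic_coeff q"
    and hl: "expandable N h" "expandable N l" and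
    e: "\<forall>\<^sub>F t in at_top. f t = p t + h t / t" "\<forall>\<^sub>F t in at_top. g t = q t + l t / t"
    by auto
  define s where "s = (\<lambda>t. (p t * l t + q t * h t) + h t * l t / t)"
  from e have "\<forall>\<^sub>F t in at_top. f t * g t = p t * q t + s t / t"
    by eventually_elim (simp add: add_divide_distrib s_def algebra_simps)
  moreover have "expandable N s" unfolding s_def
    by (intro expandable_add Suc.IH expandable_Suc_imp[OF expandable_div] hl expandable_periodic p)
  ultimately show ?case using periodic_coeff_mult p by auto
qed

lemma expandable_power: "expandable N f \<Longrightarrow> expandable N (\<lambda>t. f t ^ n)"
  by (induction n) (auto intro: expandable_mult expandable_const simp del: expandable.simps)

lemma expandable_minus: "expandable N f \<Longrightarrow> expandable N (\<lambda>t. - f t)"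
  using expandable_mult[OF expandable_const[of N "-1"]] by force

lemma expandable_diff: "expandable N f \<Longrightarrow> expandable N g \<Longrightarrow> expandable N (\<lambda>t. f t - g t)"
  using expandable_add[OF _ expandable_minus, of N f g] by simp

lemma expandable_sum: "(\<And>i. i \<in> I \<Longrightarrow> expandable N (f i)) \<Longrightarrow> expandable N (\<lambda>t. \<Sum>i\<in>I. f i t)"
  by (induction I rule: infinite_finite_induct) (auto intro: expandable_add expandable_const simp del: expandable.simps)

lemma expandable_div_same: "expandable N f \<Longrightarrow> expandable N (\<lambda>t. f t / t)"
  by (rule expandable_Suc_imp[OF expandable_div])

lemmas expandable_intros = expandable_add expandable_mult expandable_const expandable_power
  expandable_minus expandable_diff expandable_sum

lemma expandable_div_power: "expandable N h \<Longrightarrow> expandable (n + N) (\<lambda>t. h t / t ^ n)"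
proof (induction n)
  case (Suc n)
  have "expandable (Suc (n + N)) (\<lambda>t. h t / t ^ n / t)" using Suc by (intro expandable_div) auto
  then show ?case by (simp add: mult.commute del: expandable.simps)
qed (simp del: expandable.simps)

lemma DERIV_divide_power:
  fixes P :: "real \<Rightarrow> real"
  assumes "(P has_real_derivative d) (at t)" "t \<noteq> 0"
  shows "((\<lambda>t. P t / t ^ Suc n) has_real_derivative
           d / t ^ Suc n - real (Suc n) * P t / t ^ Suc (Suc n)) (at t)"
proof -
  have "((\<lambda>t. P t / t ^ Suc n) has_real_derivative
      (d * t ^ Suc n - P t * (real (Suc n) * t ^ n)) / (t ^ Suc n * t ^ Suc n)) (at t)"
    using DERIV_divide[OF assms(1) DERIV_pow[of "Suc n" t UNIV]] assms(2) by simp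
  moreover have "(d * t ^ Suc n - P t * (real (Suc n) * t ^ n)) / (t ^ Suc n * t ^ Suc n)
     = d / t ^ Suc n - real (Suc n) * P t / t ^ Suc (Suc n)"
    using assms(2) by (simp add: diff_divide_distrib mult.assoc del: of_nat_Suc)
  ultimately show ?thesis by simp
qed

text \<open>
  The functions \<open>f - G\<close> and \<open>f + G\<close> are increasing and decreasing respectively, and the first
  lies below the second everywhere; any number between their ranges serves as \<open>c\<close>.  This gives the limit of
  \<open>f\<close> together with the rate of convergence.
\<close>

lemma bounded_by_derivative:
  fixes f f' G G' :: "real \<Rightarrow> real"
  assumes "\<And>t. t \<ge> t0 \<Longrightarrow> (f has_real_derivative f' t) (at t)"
    and "\<And>t. t \<ge> t0 \<Longrightarrow> (G has_real_derivative - G' t) (at t)"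
    and "\<And>t. t \<ge> t0 \<Longrightarrow> \<bar>f' t\<bar> \<le> G' t" and "\<And>t. t \<ge> t0 \<Longrightarrow> 0 \<le> G t"
  obtains c where "\<And>t. t \<ge> t0 \<Longrightarrow> \<bar>f t - c\<bar> \<le> G t"
proof -
  have dec: "f t + G t \<le> f s + G s" if "t0 \<le> s" "s \<le> t" for s t
  proof (rule DERIV_nonpos_imp_nonincreasing[OF that(2)])
    fix x assume "s \<le> x" "x \<le> t"
    then show "\<exists>y. ((\<lambda>x. f x + G x) has_real_derivative y) (at x) \<and> y \<le> 0"
      using that assms(3)[of x]
      by (intro exI[of _ "f' x + (- G' x)"] conjI DERIV_add assms(1,2)) (auto simp: abs_le_iff)
  qed
  have inc: "f s - G s \<le> f t - G t" if "t0 \<le> s" "s \<le> t" for s t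
  proof (rule DERIV_nonneg_imp_nondecreasing[OF that(2)])
    fix x assume "s \<le> x" "x \<le> t"
    then show "\<exists>y. ((\<lambda>x. f x - G x) has_real_derivative y) (at x) \<and> 0 \<le> y"
      using that assms(3)[of x]
      by (intro exI[of _ "f' x - (- G' x)"] conjI DERIV_diff assms(1,2)) (auto simp: abs_le_iff)
  qed
  have le: "f s - G s \<le> f t + G t" if "t0 \<le> s" "t0 \<le> t" for s t
  proof (cases "s \<le> t")
    case True
    with inc[of s t] assms(4)[of t] that show ?thesis by auto
  next
    case False
    with dec[of t s] assms(4)[of s] that show ?thesis by auto
  qed
  define c where "c = (SUP s\<in>{t0..}. f s - G s)"
  have "f t - G t \<le> c" if "t \<ge> t0" for t
    unfolding c_def using that le[of _ t0] by (intro cSUP_upper) (auto intro!: bdd_aboveI)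
  moreover have "c \<le> f t + G t" if "t \<ge> t0" for t
    unfolding c_def using that le[of _ t] by (intro cSUP_least) auto
  ultimately show ?thesis using that[of c] by (force simp: abs_le_iff)
qed

lemma expandable_0_antiderivative:
  assumes "expandable 0 h"
    and "\<forall>\<^sub>F t in at_top. (f has_real_derivative h t / t ^ (n + 2)) (at t)"
  shows "expandable (Suc n) f"
proof -
  obtain K where "K > 0" and "\<forall>\<^sub>F t in at_top. \<bar>h t\<bar> \<le> K" using assms(1) by (rule expandable_0D)
  then have "\<forall>\<^sub>F t in at_top. t \<ge> 1 \<and> \<bar>h t\<bar> \<le> K \<and> (f has_real_derivative h t / t ^ (n + 2)) (at t)"
    using assms(2) by (intro eventually_conj eventually_ge_at_top)
  then obtain t0 where t0: "\<And>t. t \<ge> t0 \<Longrightarrow> t \<ge> 1 \<and> \<bar>h t\<bar> \<le> K \<and> (f has_real_derivative h t / t ^ (n + 2)) (at t)"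
    by (auto simp: eventually_at_top_linorder)
  define L where "L = K / real (n + 1)"
  have KL: "K = L * real (n + 1)" by (simp add: L_def)
  obtain c where c: "\<And>t. t \<ge> t0 \<Longrightarrow> \<bar>f t - c\<bar> \<le> L / t ^ (n + 1)"
  proof (rule bounded_by_derivative[of t0 f "\<lambda>t. h t / t ^ (n + 2)" "\<lambda>t. L / t ^ (n + 1)" "\<lambda>t. K / t ^ (n + 2)"])
    fix t assume "t \<ge> t0"
    note t = t0[OF this]
    show "((\<lambda>t. L / t ^ (n + 1)) has_real_derivative - (K / t ^ (n + 2))) (at t)"
      using t DERIV_divide_power[OF DERIV_const[of L], of t n] by (simp add: KL mult.commute)
    show "\<bar>h t / t ^ (n + 2)\<bar> \<le> K / t ^ (n + 2)"
      using t by (simp add: abs_divide divide_right_mono)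
    show "0 \<le> L / t ^ (n + 1)" using t \<open>K > 0\<close> by (simp add: L_def)
  qed (use t0 in auto)
  have "\<forall>\<^sub>F t in at_top. \<bar>(f t - c) * t ^ (n + 1)\<bar> \<le> L"
    using eventually_ge_at_top[of t0]
  proof eventually_elim
    case (elim t)
    with c[OF elim] t0[OF elim] show ?case by (simp add: abs_mult pos_le_divide_eq)
  qed
  then have "expandable 0 (\<lambda>t. (f t - c) * t ^ (n + 1))" by auto
  then have "expandable (n + 1 + 0) (\<lambda>t. (f t - c) * t ^ (n + 1) / t ^ (n + 1))"
    by (rule expandable_div_power)
  then have "expandable (n + 1 + 0) (\<lambda>t. c + (f t - c) * t ^ (n + 1) / t ^ (n + 1))"
    by (intro expandable_add expandable_const)
  moreover have "\<forall>\<^sub>F t in at_top. f t = c + (f t - c) * t ^ (n + 1) / t ^ (n + 1)"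
    using eventually_gt_at_top[of 0] by eventually_elim simp
  ultimately show ?thesis by (simp del: expandable.simps add: expandable_cong)
qed

text \<open>
  Integration by parts: if \<open>p = \<mu> + P'\<close>, then \<open>p / t\<^sup>n\<^sup>+\<^sup>2\<close> is, up to the derivative of
  \<open>- \<mu> / ((n + 1) t\<^sup>n\<^sup>+\<^sup>1) + P / t\<^sup>n\<^sup>+\<^sup>2\<close>, the term \<open>(n + 2) P / t\<^sup>n\<^sup>+\<^sup>3\<close> of the next order.  Starting at the
  power \<open>t\<^sup>-\<^sup>2\<close> is essential, since the mean of a \<open>t\<^sup>-\<^sup>1\<close> coefficient would integrate to a logarithm.
\<close>

lemma expandable_antiderivative_aux:
  assumes "expandable N h"
    and "\<forall>\<^sub>F t in at_top. (f has_real_derivative h t / t ^ (n + 2)) (at t)"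
  shows "expandable (Suc n + N) f"
  using assms
proof (induction N arbitrary: n f h)
  case 0
  then show ?case using expandable_0_antiderivative by (simp del: expandable.simps)
next
  case (Suc N)
  then obtain p l where p: "periodic_coeff p" and l: "expandable N l"
    and h: "\<forall>\<^sub>F t in at_top. h t = p t + l t / t" by auto
  obtain \<mu> P where P: "periodic_coeff P" "\<And>t. (P has_real_derivative (p t - \<mu>)) (at t)"
    using periodic_coeff_antiderivative[OF p] by blast
  define F where "F = (\<lambda>t. f t + (\<mu> / real (n + 1)) / t ^ (n + 1) - P t / t ^ (n + 2))"
  define d where "d = (\<lambda>t. l t + real (n + 2) * P t)"
  have "\<forall>\<^sub>F t in at_top. (F has_real_derivative d t / t ^ (Suc n + 2)) (at t)"
    using Suc.prems(2) h eventually_gt_at_top[of 0]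
  proof eventually_elim
    case (elim t)
    define \<alpha> where "\<alpha> = \<mu> / real (n + 1)"
    have mu: "\<mu> = \<alpha> * real (n + 1)" by (simp add: \<alpha>_def)
    have d1: "((\<lambda>t. \<alpha> / t ^ (n + 1)) has_real_derivative - \<mu> / t ^ (n + 2)) (at t)"
      using elim DERIV_divide_power[OF DERIV_const[of \<alpha>], of t n] by (simp add: mu mult.commute)
    have d2: "((\<lambda>t. P t / t ^ (n + 2)) has_real_derivative
        (p t - \<mu>) / t ^ (n + 2) - real (n + 2) * P t / t ^ (n + 3)) (at t)"
      using elim DERIV_divide_power[OF P(2)[of t], of "Suc n"] by (simp add: eval_nat_numeral)
    have "(F has_real_derivative h t / t ^ (n + 2) + - \<mu> / t ^ (n + 2)
       - ((p t - \<mu>) / t ^ (n + 2) - real (n + 2) * P t / t ^ (n + 3))) (at t)"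
      unfolding F_def \<alpha>_def[symmetric] by (intro DERIV_diff DERIV_add elim d1 d2)
    moreover have "h t / t ^ (n + 2) + - \<mu> / t ^ (n + 2)
       - ((p t - \<mu>) / t ^ (n + 2) - real (n + 2) * P t / t ^ (n + 3)) = d t / t ^ (Suc n + 2)"
      unfolding d_def elim using elim by (simp add: divide_simps power_add power2_eq_square power3_eq_cube)
         (simp add: algebra_simps)
    ultimately show ?case by simp
  qed
  moreover have "expandable N d"
    unfolding d_def by (intro expandable_intros l expandable_periodic P)
  ultimately have F: "expandable (Suc (Suc n) + N) F" by (intro Suc.IH)
  have 1: "expandable (n + 1 + Suc N) (\<lambda>t. (\<mu> / real (n + 1)) / t ^ (n + 1))"
    by (intro expandable_div_power expandable_const)
  have 2: "expandable (n + 2 + N) (\<lambda>t. P t / t ^ (n + 2))"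
    by (intro expandable_div_power expandable_periodic P)
  have "expandable (Suc n + Suc N) (\<lambda>t. F t - (\<mu> / real (n + 1)) / t ^ (n + 1) + P t / t ^ (n + 2))"
    using F 1 2 by (intro expandable_intros) (simp_all del: expandable.simps)
  then show ?case by (simp add: F_def del: expandable.simps)
qed

lemma expandable_antiderivative:
  assumes "expandable N h" and "\<forall>\<^sub>F t in at_top. (f has_real_derivative h t / t\<^sup>2) (at t)"
  shows "expandable (Suc N) f"
  using expandable_antiderivative_aux[of N h f 0] assms by (simp del: expandable.simps add: numeral_2_eq_2)

text \<open>
  Expandability to order \<open>N\<close> only provides a leading coefficient depending on \<open>N\<close>.  Two such
  coefficients differ by a periodic function that tends to \<open>0\<close>, hence coincide, and so
  the remainders eventually coincide as well.
\<close>

lemma expandable_all_step: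
  assumes "\<And>N. expandable N g"
  shows "\<exists>p h. periodic_coeff p \<and> (\<forall>N. expandable N h) \<and> (\<forall>\<^sub>F t in at_top. g t = p t + h t / t)"
proof -
  have "\<exists>p h. periodic_coeff p \<and> expandable N h \<and> (\<forall>\<^sub>F t in at_top. g t = p t + h t / t)" for N
    using assms[of "Suc N"] by simp
  then obtain p h where ph: "\<And>N. periodic_coeff (p N)" "\<And>N. expandable N (h N)"
    "\<And>N. \<forall>\<^sub>F t in at_top. g t = p N t + h N t / t" by metis
  have eq: "p N t = p 0 t" for N t
  proof -
    define q where "q = (\<lambda>t. p N t - p 0 t)"
    have pq: "periodic_coeff q" unfolding q_def using ph(1)
      using periodic_coeff_add[OF ph(1)[of N] periodic_coeff_mult[OF periodic_coeff_const[of "-1"] ph(1)[of 0]]]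
      by simp
    define e where "e = (\<lambda>t. h 0 t - h N t)"
    have "expandable 0 e" unfolding e_def
      by (intro expandable_intros ph(2) expandable_mono[of 0 N, OF _ ph(2)]) simp
    then obtain K where K: "\<forall>\<^sub>F t in at_top. \<bar>e t\<bar> \<le> K" by auto
    have "\<forall>\<^sub>F t in at_top. norm (q t) \<le> K / t"
      using ph(3)[of 0] ph(3)[of N] K eventually_gt_at_top[of 0]
    proof eventually_elim
      case (elim t)
      have "q t = e t / t" using elim(1,2,4) by (simp add: q_def e_def field_simps)
      with elim(3,4) show ?case by (simp add: abs_divide divide_right_mono)
    qed
    moreover have "((\<lambda>t. K / t) \<longlongrightarrow> 0) at_top"
      by (intro tendsto_divide_0[OF tendsto_const] filterlim_at_top_imp_at_infinity filterlim_ident)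
    ultimately have "(q \<longlongrightarrow> 0) at_top" by (rule Lim_null_comparison)
    from periodic_coeff_tendsto_0[OF pq this] show ?thesis by (simp add: q_def)
  qed
  have "expandable N (h 0)" for N
  proof (rule expandable_cong[OF _ ph(2)[of N]])
    show "\<forall>\<^sub>F t in at_top. h 0 t = h N t"
      using ph(3)[of 0] ph(3)[of N] eventually_gt_at_top[of 0]
      by eventually_elim (simp add: eq[of N])
  qed
  with ph show ?thesis by blast
qed

lemma expandable_all_imp_asymp_expansion:
  assumes "\<And>N. expandable N g"
  shows "\<exists>\<Psi>. (\<forall>n. periodic_real (\<Psi> n)) \<and> asymp_expansion (\<lambda>t. t powr a * g t) a \<Psi>"
proof -
  \<comment> \<open>\<open>F n\<close> pairs a coefficient with the remainder after it; the first component of \<open>F 0\<close> is a dummy,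
      and \<open>\<Psi> n\<close> is the first component of \<open>F (Suc n)\<close>.\<close>
  have "\<exists>F :: nat \<Rightarrow> (real \<Rightarrow> real) \<times> (real \<Rightarrow> real). \<forall>n. ((\<forall>N. expandable N (snd (F n))) \<and> (n = 0 \<longrightarrow> snd (F n) = g)) \<and>
      (periodic_coeff (fst (F (Suc n))) \<and>
        (\<forall>\<^sub>F t in at_top. snd (F n) t = fst (F (Suc n)) t + snd (F (Suc n)) t / t))"
  proof (rule dependent_nat_choice)
    show "\<exists>x :: (real \<Rightarrow> real) \<times> (real \<Rightarrow> real). (\<forall>N. expandable N (snd x)) \<and> (0 = (0::nat) \<longrightarrow> snd x = g)"
      by (intro exI[of _ "(g, g)"]) (simp add: assms del: expandable.simps)
  next
    fix x :: "(real \<Rightarrow> real) \<times> (real \<Rightarrow> real)" and n :: nat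
    assume "(\<forall>N. expandable N (snd x)) \<and> (n = 0 \<longrightarrow> snd x = g)"
    then obtain p h where "periodic_coeff p" "\<forall>N. expandable N h"
      "\<forall>\<^sub>F t in at_top. snd x t = p t + h t / t" using expandable_all_step[of "snd x"] by blast
    then show "\<exists>y. ((\<forall>N. expandable N (snd y)) \<and> (Suc n = 0 \<longrightarrow> snd y = g)) \<and>
        periodic_coeff (fst y) \<and> (\<forall>\<^sub>F t in at_top. snd x t = fst y t + snd y t / t)"
      by (intro exI[of _ "(p, h)"]) simp
  qed
  then obtain F where F': "\<And>n. ((\<forall>N. expandable N (snd (F n))) \<and> (n = 0 \<longrightarrow> snd (F n) = g)) \<and>
      (periodic_coeff (fst (F (Suc n))) \<and>
        (\<forall>\<^sub>F t in at_top. snd (F n) t = fst (F (Suc n)) t + snd (F (Suc n)) t / t))"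
    by (elim exE) blast
  have F: "expandable N (snd (F n))" "snd (F 0) = g" "periodic_coeff (fst (F (Suc n)))"
     "\<forall>\<^sub>F t in at_top. snd (F n) t = fst (F (Suc n)) t + snd (F (Suc n)) t / t" for n N
    using F'[of n] F'[of 0] by (simp_all del: expandable.simps)
  define \<Psi> where "\<Psi> n = fst (F (Suc n))" for n
  define h where "h n = snd (F n)" for n
  have rem: "\<forall>\<^sub>F t in at_top. g t = (\<Sum>n=0..N. \<Psi> n t * t powr (- real n)) + h (Suc N) t / t ^ Suc N" for N
  proof (induction N)
    case 0
    show ?case using F(4)[of 0] eventually_gt_at_top[of 0]
      by eventually_elim (simp add: \<Psi>_def h_def F(2))
  next
    case (Suc N)
    show ?case using Suc F(4)[of "Suc N"] eventually_gt_at_top[of 0]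
    proof eventually_elim
      case (elim t)
      have "t powr (- real (Suc N)) = 1 / t ^ Suc N"
        using elim by (simp add: powr_minus powr_realpow divide_inverse del: of_nat_Suc power_Suc)
      moreover have "h (Suc N) t / t ^ Suc N = \<Psi> (Suc N) t * (1 / t ^ Suc N) + h (Suc (Suc N)) t / t ^ Suc (Suc N)"
        using elim unfolding h_def \<Psi>_def by (simp add: field_simps)
      ultimately show ?case using elim(1) by (simp del: of_nat_Suc power_Suc)
    qed
  qed
  have "periodic_real (\<Psi> n)" for n
    unfolding periodic_real_def using F(3)[of n]
    by (intro exI[of _ "2 * pi"]) (auto simp: periodic_coeff_def \<Psi>_def periodic_fun_simple_def)
  moreover have "asymp_expansion (\<lambda>t. t powr a * g t) a \<Psi>"
    unfolding asymp_expansion_def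
  proof
    fix N
    obtain K where K: "\<forall>\<^sub>F t in at_top. \<bar>h (Suc N) t\<bar> \<le> K"
      using F(1)[of 0 "Suc N"] unfolding h_def by auto
    have "(\<lambda>t. t powr a * g t - t powr a * (\<Sum>n=0..N. \<Psi> n t * t powr (- real n)))
        \<in> O[at_top](\<lambda>t. t powr (a - real N - 1))"
    proof (rule bigoI[of _ K])
      show "\<forall>\<^sub>F t in at_top. norm (t powr a * g t - t powr a * (\<Sum>n=0..N. \<Psi> n t * t powr (- real n)))
         \<le> K * norm (t powr (a - real N - 1))"
        using rem[of N] K eventually_gt_at_top[of 0]
      proof eventually_elim
        case (elim t)
        have "t powr (a - real N - 1) = t powr a / t ^ Suc N"
          using elim powr_diff[of t a "real (Suc N)"] powr_realpow[of t "Suc N"]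
          by (simp add: algebra_simps)
        then have "t powr a * g t - t powr a * (\<Sum>n=0..N. \<Psi> n t * t powr (- real n))
            = h (Suc N) t * t powr (a - real N - 1)"
          using elim(1) by (simp add: algebra_simps)
        then show ?case using elim(2) by (simp add: abs_mult mult_right_mono)
      qed
    qed
    also have "(\<lambda>t::real. t powr (a - real N - 1)) \<in> o[at_top](\<lambda>t. t powr (a - real N))"
      by (subst powr_smallo_iff) (auto intro: filterlim_ident)
    finally show "(\<lambda>t. t powr a * g t - t powr a * (\<Sum>n=0..N. \<Psi> n t * t powr (- real n)))
        \<in> o[at_top](\<lambda>t. t powr (a - real N))" .
  qed
  ultimately show ?thesis by blast
qed

text \<open>
  Taylor's formula for \<open>(y + x)\<^sup>k\<close> with the remainder written as \<open>x\<^sup>2\<close> times a polynomial \<open>R\<close>.  All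
  that is needed of \<open>R\<close> is that it preserves expandability, which is read off its recursive
  construction.
\<close>

lemma power_second_order_remainder:
  "\<exists>R. (\<forall>N \<delta>. expandable N \<delta> \<longrightarrow> expandable N (\<lambda>t. R (\<delta> t / t))) \<and>
       (\<forall>x::real. (y + x) ^ k = y ^ k + real k * y ^ (k - 1) * x + x\<^sup>2 * R x)"
proof (induction k)
  case 0
  show ?case by (intro exI[of _ "\<lambda>x. 0"]) (simp add: expandable_0 del: expandable.simps)
next
  case (Suc k)
  then obtain R where R: "\<And>N \<delta>. expandable N \<delta> \<Longrightarrow> expandable N (\<lambda>t. R (\<delta> t / t))"
    "\<And>x. (y + x) ^ k = y ^ k + real k * y ^ (k - 1) * x + x\<^sup>2 * R x" by blast
  define Q where "Q = (\<lambda>x. real k * y ^ (k - 1) + (y + x) * R x)"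
  have "expandable N (\<lambda>t. Q (\<delta> t / t))" if "expandable N \<delta>" for N \<delta>
    unfolding Q_def by (intro expandable_intros R(1) that expandable_div_same)
  moreover have "(y + x) ^ Suc k = y ^ Suc k + real (Suc k) * y ^ (Suc k - 1) * x + x\<^sup>2 * Q x" for x
  proof -
    have "real k * y ^ k = real k * (y * y ^ (k - 1))" by (cases k) auto
    then show ?thesis unfolding Q_def power_Suc R(2)
      by (auto simp: algebra_simps power2_eq_square)
  qed
  ultimately show ?case by (intro exI[of _ Q]) blast
qed

text \<open>
  Write \<open>y = y0 + \<delta> / t\<close> with \<open>y0\<close> the \<open>k\<close>-th root of \<open>r0\<close>.  Expanding \<open>y\<^sup>k\<close> to second order turns
  the equation into \<open>\<delta> = (w - \<delta>\<^sup>2 R (\<delta> / t) / t) / (k y0\<^sup>k\<^sup>-\<^sup>1)\<close>, whose right-hand side gains one order over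
  \<open>\<delta>\<close> because of the factor \<open>1 / t\<close>.
\<close>

lemma expandable_root:
  fixes w y :: "real \<Rightarrow> real" and k :: nat
  assumes w: "\<And>N. expandable N w" and "k \<ge> 1" "r0 > 0"
    and y: "\<forall>\<^sub>F t in at_top. y t > 0 \<and> y t ^ k = r0 + w t / t"
  shows "expandable N y"
proof -
  define y0 where "y0 = root k r0"
  have y0: "y0 > 0" "y0 ^ k = r0" using assms(2,3) by (auto simp: y0_def)
  define c where "c = y0 ^ (k - 1)"
  have c: "c > 0" using y0 by (simp add: c_def)
  define \<delta> where "\<delta> = (\<lambda>t. t * (y t - y0))"
  obtain R where R: "\<And>N \<delta>. expandable N \<delta> \<Longrightarrow> expandable N (\<lambda>t. R (\<delta> t / t))"
    "\<And>x. (y0 + x) ^ k = y0 ^ k + real k * c * x + x\<^sup>2 * R x"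
    using power_second_order_remainder[of y0 k] unfolding c_def by blast
  have \<delta>: "expandable N \<delta>" for N
  proof (induction N)
    case 0
    obtain K where "\<forall>\<^sub>F t in at_top. \<bar>w t\<bar> \<le> K" using w[of 0] by auto
    then have "\<forall>\<^sub>F t in at_top. \<bar>\<delta> t\<bar> \<le> K / c"
      using y eventually_gt_at_top[of 0]
    proof eventually_elim
      case (elim t)
      \<comment> \<open>Boundedness of \<open>\<delta>\<close>: the cofactor of \<open>y - y0\<close> in \<open>y\<^sup>k - y0\<^sup>k\<close> is at least its term \<open>y0\<^sup>k\<^sup>-\<^sup>1\<close>.\<close>
      define Q where "Q = (\<Sum>i<k. y0 ^ (k - Suc i) * y t ^ i)"
      have "w t / t = y t ^ k - y0 ^ k" using elim y0 by simp
      also have "\<dots> = (y t - y0) * Q" unfolding Q_def by (rule power_diff_sumr2)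
      finally have wQ: "w t = \<delta> t * Q" using elim by (simp add: \<delta>_def field_simps)
      have "y0 ^ (k - Suc 0) * y t ^ 0 \<le> Q" unfolding Q_def
        using elim y0 assms(2) by (intro member_le_sum) auto
      then have "c \<le> Q" by (simp add: c_def)
      then have "\<bar>\<delta> t\<bar> * c \<le> \<bar>w t\<bar>" using c by (simp add: wQ abs_mult mult_left_mono)
      with elim c show ?case by (simp add: pos_le_divide_eq)
    qed
    then show ?case by auto
  next
    case (Suc N)
    define F where "F = (\<lambda>t. (w t - (\<delta> t)\<^sup>2 * R (\<delta> t / t) / t) * (1 / (real k * c)))"
    have "\<forall>\<^sub>F t in at_top. \<delta> t = F t" using y eventually_gt_at_top[of 0]
    proof eventually_elim
      case (elim t)
      have "y t = y0 + \<delta> t / t" using elim by (simp add: \<delta>_def)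
      then have "r0 + w t / t = r0 + real k * c * (\<delta> t / t) + (\<delta> t / t)\<^sup>2 * R (\<delta> t / t)"
        using R(2)[of "\<delta> t / t"] elim y0 by simp
      then have "t * (w t / t) = t * (real k * c * (\<delta> t / t) + (\<delta> t / t)\<^sup>2 * R (\<delta> t / t))"
        by simp
      then have "w t = real k * c * \<delta> t + (\<delta> t)\<^sup>2 * R (\<delta> t / t) / t"
        using elim by (simp add: distrib_left power2_eq_square)
      then show ?case using c assms(2) by (simp add: F_def)
    qed
    moreover have "expandable (Suc N) F"
      unfolding F_def by (intro expandable_intros w expandable_div R(1) Suc)
    ultimately show ?case by (rule expandable_cong)
  qed
  have "\<forall>\<^sub>F t in at_top. y t = y0 + \<delta> t / t"
    using eventually_gt_at_top[of 0] by eventually_elim (simp add: \<delta>_def)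
  then show ?thesis
    by (rule expandable_cong) (intro expandable_intros expandable_div_same \<delta>)
qed

section \<open>Averages of even powers of the sine\<close>

text \<open>
  The mean of \<open>sin\<^sup>2\<^sup>p\<close> over a period, by Wallis' recursion; \<open>sin_power_primitive p\<close> is the periodic primitive
  of \<open>sin\<^sup>2\<^sup>p\<close> minus that mean, written as a polynomial in \<open>c = cos \<theta>\<close> and \<open>s = sin \<theta>\<close>.
\<close>

primrec sin_power_mean :: "nat \<Rightarrow> real" where
  "sin_power_mean 0 = 1"
| "sin_power_mean (Suc p) = (2 * real p + 1) / (2 * real p + 2) * sin_power_mean p"

primrec sin_power_primitive :: "nat \<Rightarrow> real \<Rightarrow> real \<Rightarrow> real" where
  "sin_power_primitive 0 c s = 0"
| "sin_power_primitive (Suc p) c s =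
     (2 * real p + 1) / (2 * real p + 2) * sin_power_primitive p c s
       - s ^ (2 * p + 1) * c / (2 * real p + 2)"

lemma sin_power_mean_pos: "sin_power_mean p > 0"
  by (induction p) auto

lemma sin_power_primitive_deriv:
  assumes "(C has_real_derivative - S t * \<tau>) (at t)" "(S has_real_derivative C t * \<tau>) (at t)"
    and "(C t)\<^sup>2 + (S t)\<^sup>2 = (1::real)"
  shows "((\<lambda>t. sin_power_primitive p (C t) (S t)) has_real_derivative
            (S t ^ (2 * p) - sin_power_mean p) * \<tau>) (at t)"
proof (induction p)
  case (Suc p)
  define \<beta> where "\<beta> = (2 * real p + 1) / (2 * real p + 2)"
  have \<beta>1: "1 / (2 * real p + 2) = 1 - \<beta>" by (simp add: \<beta>_def field_simps)
  have d: "((\<lambda>t. S t ^ (2 * p + 1) * C t / (2 * real p + 2)) has_real_derivative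
      ((2 * real p + 1) * S t ^ (2 * p) * (C t * \<tau>) * C t + S t ^ (2 * p + 1) * (- S t * \<tau>))
        / (2 * real p + 2)) (at t)"
    using DERIV_cdivide[OF DERIV_mult[OF DERIV_power_Suc[OF assms(2), of "2 * p"] assms(1)],
        of "2 * real p + 2"]
    by (simp add: algebra_simps)
  have "((2 * real p + 1) * S t ^ (2 * p) * (C t * \<tau>) * C t + S t ^ (2 * p + 1) * (- S t * \<tau>))
        / (2 * real p + 2)
      = ((2 * real p + 1) * (1 / (2 * real p + 2))) * S t ^ (2 * p) * (C t)\<^sup>2 * \<tau>
        - (1 / (2 * real p + 2)) * S t ^ (2 * p) * (S t)\<^sup>2 * \<tau>"
    by (simp add: diff_divide_distrib power2_eq_square mult_ac)
  also have "(2 * real p + 1) * (1 / (2 * real p + 2)) = \<beta>" by (simp add: \<beta>_def)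
  also have "\<beta> * S t ^ (2 * p) * (C t)\<^sup>2 * \<tau> - (1 / (2 * real p + 2)) * S t ^ (2 * p) * (S t)\<^sup>2 * \<tau>
      = (\<beta> * S t ^ (2 * p) - S t ^ (2 * Suc p)) * \<tau>"
  proof -
    have C2: "(C t)\<^sup>2 = 1 - (S t)\<^sup>2" using assms(3) by simp
    show ?thesis unfolding \<beta>1 C2 by (simp add: algebra_simps power2_eq_square)
  qed
  finally have d': "((\<lambda>t. S t ^ (2 * p + 1) * C t / (2 * real p + 2)) has_real_derivative
     (\<beta> * S t ^ (2 * p) - S t ^ (2 * Suc p)) * \<tau>) (at t)" using d by simp
  have "((\<lambda>t. \<beta> * sin_power_primitive p (C t) (S t) - S t ^ (2 * p + 1) * C t / (2 * real p + 2))
     has_real_derivative \<beta> * ((S t ^ (2 * p) - sin_power_mean p) * \<tau>)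
        - (\<beta> * S t ^ (2 * p) - S t ^ (2 * Suc p)) * \<tau>) (at t)"
    by (intro DERIV_diff DERIV_cmult Suc d')
  moreover have "\<beta> * ((S t ^ (2 * p) - sin_power_mean p) * \<tau>)
        - (\<beta> * S t ^ (2 * p) - S t ^ (2 * Suc p)) * \<tau> = (S t ^ (2 * Suc p) - sin_power_mean (Suc p)) * \<tau>"
  proof -
    have "sin_power_mean (Suc p) = \<beta> * sin_power_mean p" by (simp add: \<beta>_def)
    then show ?thesis by (simp add: algebra_simps del: sin_power_mean.simps)
  qed
  ultimately show ?case by (simp add: \<beta>_def[symmetric] del: sin_power_mean.simps)
qed simp

lemma sin_power_primitive_expandable:
  assumes "expandable N C" "expandable N S"
  shows "expandable N (\<lambda>t. sin_power_primitive p (C t) (S t))"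
proof (induction p)
  case (Suc p)
  have "expandable N (\<lambda>t. (2 * real p + 1) / (2 * real p + 2) * sin_power_primitive p (C t) (S t)
       - S t ^ (2 * p + 1) * C t * (1 / (2 * real p + 2)))"
    by (intro expandable_intros Suc assms)
  then show ?case by (simp del: expandable.simps)
qed (simp add: expandable_0 del: expandable.simps)

section \<open>The oscillator in polar form\<close>

text \<open>
  The phase \<open>\<theta>\<close> enters only through \<open>C = cos \<theta>\<close> and \<open>S = sin \<theta>\<close>.  This avoids choosing
  a continuous argument and keeps every expression polynomial.
\<close>

locale slow_fast_system =
  fixes \<nu> :: real and k m :: nat and u C S :: "real \<Rightarrow> real" and t0 :: real
  assumes nu: "\<nu> > 0" and m: "m \<ge> 1" and k: "k = 2 * m" and t0: "t0 > 0"
    and unit: "t \<ge> t0 \<Longrightarrow> (C t)\<^sup>2 + (S t)\<^sup>2 = 1"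
    and u_pos: "t \<ge> t0 \<Longrightarrow> u t > 0"
    and u_deriv: "t \<ge> t0 \<Longrightarrow> (u has_real_derivative real k * \<nu> * S t ^ (k + 2)) (at t)"
    and C_deriv: "t \<ge> t0 \<Longrightarrow>
       (C has_real_derivative - S t * (1 - \<nu> * (C t * S t ^ (k + 1)) * (1 / u t))) (at t)"
    and S_deriv: "t \<ge> t0 \<Longrightarrow>
       (S has_real_derivative C t * (1 - \<nu> * (C t * S t ^ (k + 1)) * (1 / u t))) (at t)"
begin

text \<open>
  The phase speed \<open>\<theta>'\<close>.
\<close>

definition "\<tau> t = 1 - \<nu> * (C t * S t ^ (k + 1)) * (1 / u t)"

lemma C_deriv': "t \<ge> t0 \<Longrightarrow> (C has_real_derivative - S t * \<tau> t) (at t)"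
  and S_deriv': "t \<ge> t0 \<Longrightarrow> (S has_real_derivative C t * \<tau> t) (at t)"
  using C_deriv S_deriv by (auto simp: \<tau>_def)

lemma C_le_1: "t \<ge> t0 \<Longrightarrow> \<bar>C t\<bar> \<le> 1" and S_le_1: "t \<ge> t0 \<Longrightarrow> \<bar>S t\<bar> \<le> 1"
proof -
  assume "t \<ge> t0"
  from unit[OF this] have "(C t)\<^sup>2 \<le> 1" "(S t)\<^sup>2 \<le> 1"
    using zero_le_power2[of "C t"] zero_le_power2[of "S t"] by linarith+
  then show "\<bar>C t\<bar> \<le> 1" "\<bar>S t\<bar> \<le> 1" by (auto simp: abs_square_le_1)
qed

lemma even_power: "S t ^ (k + 2) = ((S t)\<^sup>2) ^ (m + 1)"
proof -
  have "k + 2 = 2 * (m + 1)" by (simp add: k)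
  then show ?thesis by (simp only: power_mult)
qed

lemma u_mono:
  assumes "t0 \<le> s" "s \<le> t"
  shows "u s \<le> u t"
proof (rule DERIV_nonneg_imp_nondecreasing[OF assms(2)])
  fix x assume "s \<le> x" "x \<le> t"
  moreover have "real k * \<nu> * S x ^ (k + 2) \<ge> 0" unfolding even_power using nu by simp
  ultimately show "\<exists>y. (u has_real_derivative y) (at x) \<and> 0 \<le> y" using u_deriv[of x] assms by auto
qed

text \<open>
  The rate \<open>u' = k \<nu> S\<^sup>k\<^sup>+\<^sup>2\<close> vanishes where \<open>S = 0\<close>.  Adding a small multiple of the bounded function
  \<open>S C\<close> cures this, because its derivative is close to \<open>1\<close> where \<open>S\<close> is small; where \<open>S\<close> is not small the
  growth of \<open>u\<close> itself dominates.  No smallness of \<open>1 / u\<close> may be assumed at this stage: only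
  \<open>u \<ge> u t0\<close> is available.
\<close>

lemma linear_growth: obtains c where "c > 0" "\<forall>\<^sub>F t in at_top. c * t \<le> u t"
proof -
  define K where "K = \<nu> / u t0"
  have K: "K > 0" using nu u_pos[of t0] by (simp add: K_def)
  define B where "B = 2 + K"
  define \<sigma>0 where "\<sigma>0 = 1 / (2 * B)"
  \<comment> \<open>\<open>\<sigma>0\<close> separates small from large values of \<open>S\<^sup>2\<close>: below it \<open>1 - B S\<^sup>2 \<ge> 1 / 2\<close>, and \<open>\<epsilon>\<close> is chosen
      such that above it the term \<open>k \<nu> S\<^sup>k\<^sup>+\<^sup>2\<close> is at least \<open>\<epsilon> B\<close>.\<close>
  define \<epsilon> where "\<epsilon> = real k * \<nu> * \<sigma>0 ^ (m + 1) / B"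
  have B: "B > 0" using K by (simp add: B_def)
  have s0: "\<sigma>0 > 0" using B by (simp add: \<sigma>0_def)
  have e: "\<epsilon> > 0" using B s0 nu m by (simp add: \<epsilon>_def k)
  define L where "L = (\<lambda>t. u t + \<epsilon> * (S t * C t) - \<epsilon> / 2 * t)"
  have L: "L t0 \<le> L t" if "t0 \<le> t" for t
  proof (rule DERIV_nonneg_imp_nondecreasing[OF that])
    fix x assume x: "t0 \<le> x" "x \<le> t"
    define \<sigma> where "\<sigma> = (S x)\<^sup>2"
    have \<sigma>: "0 \<le> \<sigma>" "\<sigma> \<le> 1" using S_le_1[OF x(1)] by (auto simp: \<sigma>_def abs_square_le_1)
    have "(L has_real_derivative real k * \<nu> * S x ^ (k + 2)
        + \<epsilon> * (C x * \<tau> x * C x + S x * (- S x * \<tau> x)) - \<epsilon> / 2) (at x)"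
      unfolding L_def
      by (auto intro!: derivative_eq_intros u_deriv C_deriv' S_deriv' x simp: algebra_simps)
    moreover have "C x * \<tau> x * C x + S x * (- S x * \<tau> x) = (1 - 2 * \<sigma>) * \<tau> x"
    proof -
      have "C x * \<tau> x * C x + S x * (- S x * \<tau> x) = ((C x)\<^sup>2 - \<sigma>) * \<tau> x"
        by (simp add: \<sigma>_def algebra_simps power2_eq_square)
      also have "(C x)\<^sup>2 - \<sigma> = 1 - 2 * \<sigma>" using unit[OF x(1)] by (simp add: \<sigma>_def)
      finally show ?thesis .
    qed
    moreover have "(1 - 2 * \<sigma>) * \<tau> x \<ge> 1 - B * \<sigma>"
    proof -
      have "\<bar>1 / u x\<bar> \<le> 1 / u t0"
        using u_pos[of t0] u_pos[of x] x u_mono[of t0 x] by (simp add: frac_le)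
      then have "\<bar>\<nu> * (1 / u x)\<bar> \<le> K" unfolding abs_mult K_def
        using nu by (simp add: divide_inverse mult_left_mono)
      moreover have "\<bar>C x * S x ^ (k + 1)\<bar> \<le> \<sigma>"
      proof -
        have "\<bar>S x\<bar> ^ (k + 1) \<le> \<bar>S x\<bar> ^ 2"
          using S_le_1[OF x(1)] k m by (intro power_decreasing) auto
        then have "\<bar>C x\<bar> * \<bar>S x\<bar> ^ (k + 1) \<le> 1 * \<bar>S x\<bar> ^ 2"
          using C_le_1[OF x(1)] by (intro mult_mono) auto
        then show ?thesis by (simp add: abs_mult power_abs \<sigma>_def)
      qed
      ultimately have "\<bar>\<nu> * (1 / u x)\<bar> * \<bar>C x * S x ^ (k + 1)\<bar> \<le> K * \<sigma>"
        using K by (intro mult_mono) auto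
      then have *: "\<bar>1 - \<tau> x\<bar> \<le> K * \<sigma>" by (simp add: \<tau>_def abs_mult mult_ac)
      have "\<bar>1 - 2 * \<sigma>\<bar> * \<bar>1 - \<tau> x\<bar> \<le> 1 * (K * \<sigma>)"
        using * \<sigma> by (intro mult_mono) auto
      then have "(1 - 2 * \<sigma>) * (1 - \<tau> x) \<le> K * \<sigma>"
        by (metis abs_le_D1 abs_mult mult_1)
      then show ?thesis by (simp add: B_def algebra_simps)
    qed
    moreover have "real k * \<nu> * \<sigma> ^ (m + 1) + \<epsilon> * (1 - B * \<sigma>) \<ge> \<epsilon> / 2"
    proof (cases "\<sigma> \<le> \<sigma>0")
      case True
      then have "B * \<sigma> \<le> 1 / 2" using B by (simp add: \<sigma>0_def field_simps)
      then have "\<epsilon> * (1 / 2) \<le> \<epsilon> * (1 - B * \<sigma>)" using e by (intro mult_left_mono) auto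
      moreover have "real k * \<nu> * \<sigma> ^ (m + 1) \<ge> 0" using nu \<sigma> by simp
      ultimately show ?thesis by simp
    next
      case False
      then have "real k * \<nu> * \<sigma>0 ^ (m + 1) \<le> real k * \<nu> * \<sigma> ^ (m + 1)"
        using nu s0 by (intro mult_left_mono power_mono) auto
      then have "\<epsilon> * B \<le> real k * \<nu> * \<sigma> ^ (m + 1)" using B by (simp add: \<epsilon>_def)
      moreover have "\<epsilon> * B * \<sigma> \<le> \<epsilon> * B * 1" using e B \<sigma> by (intro mult_left_mono) auto
      ultimately show ?thesis using e by (simp add: algebra_simps)
    qed
    moreover have "\<epsilon> * (1 - B * \<sigma>) \<le> \<epsilon> * ((1 - 2 * \<sigma>) * \<tau> x)" if "1 - B * \<sigma> \<le> (1 - 2 * \<sigma>) * \<tau> x"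
      using that e by simp
    ultimately show "\<exists>y. (L has_real_derivative y) (at x) \<and> 0 \<le> y"
      unfolding even_power \<sigma>_def[symmetric] by (intro exI conjI) (assumption, simp)
  qed
  have "\<epsilon> / 4 * t \<le> u t" if "t \<ge> t0" "t \<ge> 4 / \<epsilon> * (\<epsilon> - L t0)" for t
  proof -
    have "\<bar>S t\<bar> * \<bar>C t\<bar> \<le> 1 * 1" using S_le_1 C_le_1 that by (intro mult_mono) auto
    then have "S t * C t \<le> 1" by (metis abs_le_D1 abs_mult mult_1)
    then have "\<epsilon> * (S t * C t) \<le> \<epsilon> * 1" using e by (intro mult_left_mono) auto
    with L[OF that(1)] have "u t \<ge> L t0 - \<epsilon> + \<epsilon> / 2 * t" unfolding L_def by simp
    moreover have "\<epsilon> / 4 * t \<ge> \<epsilon> - L t0"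
    proof -
      have "\<epsilon> / 4 * t \<ge> \<epsilon> / 4 * (4 / \<epsilon> * (\<epsilon> - L t0))" using that e by (intro mult_left_mono) auto
      then show ?thesis using e by simp
    qed
    ultimately show ?thesis by (simp add: field_simps)
  qed
  then have "\<forall>\<^sub>F t in at_top. \<epsilon> / 4 * t \<le> u t"
    by (intro eventually_at_top_linorderI[of "max t0 (4 / \<epsilon> * (\<epsilon> - L t0))"]) simp
  then show ?thesis using that[of "\<epsilon> / 4"] e by simp
qed

end

context slow_fast_system
begin

section \<open>Removal of the terms of order 1/u\<close>

text \<open>
  Here \<open>damp\<close> is \<open>u'\<close>, \<open>a\<close> its mean, and \<open>g\<close> the factor of \<open>- \<nu> / u\<close> in the phase speed.
  As functions of the phase, \<open>G\<close> is a primitive of \<open>g\<close>, \<open>h\<close> is one of \<open>a - damp\<close>, and \<open>q\<close> is one of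
  \<open>\<nu> (a - damp) g\<close>.  That \<open>G\<close> and \<open>q\<close> are periodic, and indeed polynomials in \<open>S\<close>, is what excludes
  logarithms.
\<close>

definition "z t = 1 / u t"
definition "damp t = real k * \<nu> * S t ^ (k + 2)"
definition "g t = C t * S t ^ (k + 1)"
definition "G t = S t ^ (k + 2) / real (k + 2)"
definition "a = real k * \<nu> * sin_power_mean (m + 1)"
definition "h t = - (real k * \<nu>) * sin_power_primitive (m + 1) (C t) (S t)"
definition "q t = \<nu> * (a * G t - real k * \<nu> * (S t ^ (2 * k + 4) / real (2 * k + 4)))"

lemma tau_eq: "\<tau> t = 1 - \<nu> * g t * z t"
  by (simp add: \<tau>_def g_def z_def)

lemma a_pos: "a > 0"
  unfolding a_def using nu m k sin_power_mean_pos by (intro mult_pos_pos) auto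

lemma z_deriv: "t \<ge> t0 \<Longrightarrow> (z has_real_derivative - damp t * (z t)\<^sup>2) (at t)"
proof -
  assume t: "t \<ge> t0"
  have "((\<lambda>t. 1 / u t) has_real_derivative - damp t * (1 / u t)\<^sup>2) (at t)"
    using u_pos[OF t] unfolding damp_def
    by (auto intro!: derivative_eq_intros u_deriv t simp: power2_eq_square)
  moreover have "z = (\<lambda>t. 1 / u t)" by (simp add: z_def fun_eq_iff)
  ultimately show ?thesis by simp
qed

lemma G_deriv: "t \<ge> t0 \<Longrightarrow> (G has_real_derivative g t * \<tau> t) (at t)"
proof -
  assume t: "t \<ge> t0"
  have "((\<lambda>t. S t ^ Suc (k + 1) / real (k + 2)) has_real_derivative
      (1 + real (k + 1)) * (C t * \<tau> t * S t ^ (k + 1)) / real (k + 2)) (at t)"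
    by (intro DERIV_cdivide DERIV_power_Suc S_deriv' t)
  moreover have "G = (\<lambda>t. S t ^ Suc (k + 1) / real (k + 2))" by (simp add: G_def fun_eq_iff)
  ultimately show ?thesis by (simp add: g_def mult_ac)
qed

lemma h_deriv: "t \<ge> t0 \<Longrightarrow> (h has_real_derivative (a - damp t) * \<tau> t) (at t)"
proof -
  assume t: "t \<ge> t0"
  have "(h has_real_derivative - (real k * \<nu>) * ((S t ^ (2 * (m + 1)) - sin_power_mean (m + 1)) * \<tau> t)) (at t)"
    unfolding h_def[abs_def] by (intro DERIV_cmult sin_power_primitive_deriv C_deriv' S_deriv' unit t)
  moreover have "2 * (m + 1) = k + 2" by (simp add: k)
  ultimately show ?thesis
    by (simp add: a_def damp_def algebra_simps del: sin_power_mean.simps power_Suc)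
qed

lemma q_deriv: "t \<ge> t0 \<Longrightarrow> (q has_real_derivative \<nu> * (a - damp t) * g t * \<tau> t) (at t)"
proof -
  assume t: "t \<ge> t0"
  have "((\<lambda>t. S t ^ Suc (2 * k + 3) / real (2 * k + 4)) has_real_derivative
      (1 + real (2 * k + 3)) * (C t * \<tau> t * S t ^ (2 * k + 3)) / real (2 * k + 4)) (at t)"
    by (intro DERIV_cdivide DERIV_power_Suc S_deriv' t)
  moreover have "Suc (2 * k + 3) = 2 * k + 4" by simp
  moreover have e: "(1 + real (2 * k + 3)) * (C t * \<tau> t * S t ^ (2 * k + 3)) / real (2 * k + 4)
      = S t ^ (k + 2) * g t * \<tau> t"
  proof -
    have "2 * k + 3 = (k + 2) + (k + 1)" by simp
    then have "S t ^ (2 * k + 3) = S t ^ (k + 2) * S t ^ (k + 1)" by (simp only: power_add)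
    then show ?thesis by (simp add: g_def divide_simps)
  qed
  ultimately have d: "((\<lambda>t. S t ^ (2 * k + 4) / real (2 * k + 4)) has_real_derivative
      S t ^ (k + 2) * g t * \<tau> t) (at t)"
    by (simp only: e)
  have "(q has_real_derivative \<nu> * (a * (g t * \<tau> t) - real k * \<nu> * (S t ^ (k + 2) * g t * \<tau> t))) (at t)"
    unfolding q_def[abs_def] by (intro DERIV_cmult DERIV_diff G_deriv d t)
  then show ?thesis by (simp add: damp_def algebra_simps)
qed

text \<open>
  The cosine and sine of the phase lag \<open>\<theta> - t\<close>, which vary at the rate \<open>1 / u\<close>.
\<close>

definition "A t = C t * cos t + S t * sin t"
definition "B t = S t * cos t - C t * sin t"

lemma A_deriv: "t \<ge> t0 \<Longrightarrow> (A has_real_derivative \<nu> * g t * z t * B t) (at t)"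
proof -
  assume t: "t \<ge> t0"
  have "(A has_real_derivative (1 - \<tau> t) * B t) (at t)"
    unfolding A_def[abs_def] B_def
    by (auto intro!: derivative_eq_intros C_deriv' S_deriv' t simp: algebra_simps)
  then show ?thesis by (simp add: tau_eq)
qed

lemma B_deriv: "t \<ge> t0 \<Longrightarrow> (B has_real_derivative - (\<nu> * g t * z t * A t)) (at t)"
proof -
  assume t: "t \<ge> t0"
  have "(B has_real_derivative - ((1 - \<tau> t) * A t)) (at t)"
    unfolding B_def[abs_def] A_def
    by (auto intro!: derivative_eq_intros C_deriv' S_deriv' t simp: algebra_simps)
  then show ?thesis by (simp add: tau_eq)
qed

lemma C_eq: "C t = A t * cos t - B t * sin t"
  and S_eq: "S t = B t * cos t + A t * sin t"
proof -
  have c: "(cos t)\<^sup>2 = 1 - (sin t)\<^sup>2" by (simp add: cos_squared_eq)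
  have "A t * cos t - B t * sin t = C t * ((cos t)\<^sup>2 + (sin t)\<^sup>2)"
    unfolding A_def B_def by algebra
  then show "C t = A t * cos t - B t * sin t" by simp
  have "B t * cos t + A t * sin t = S t * ((cos t)\<^sup>2 + (sin t)\<^sup>2)"
    unfolding A_def B_def by algebra
  then show "S t = B t * cos t + A t * sin t" by simp
qed

text \<open>
  Near-identity changes of variables.  Differentiating \<open>h\<close> in \<open>w_corr\<close> replaces \<open>damp\<close> by its mean \<open>a\<close>, up to
  a \<open>1 / u\<close> term caused by the phase speed, which \<open>q / u\<close> cancels in turn.  For the phase lag one correction is
  enough: \<open>A_corr\<close> and \<open>B_corr\<close> rotate \<open>(A, B)\<close> to first order by the angle \<open>\<nu> G / u\<close>.  What remains
  in each derivative is a bounded multiple of \<open>1 / u\<^sup>2\<close>.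
\<close>

definition "w_corr t = u t + h t + q t * z t - a * t"
definition "A_corr t = A t - \<nu> * (B t * (G t * z t))"
definition "B_corr t = B t + \<nu> * (A t * (G t * z t))"

lemma w_corr_deriv:
  assumes t: "t \<ge> t0"
  shows "(w_corr has_real_derivative
      - (\<nu>\<^sup>2 * (a - damp t) * (g t)\<^sup>2 + q t * damp t) * (z t)\<^sup>2) (at t)"
proof -
  have u': "(u has_real_derivative damp t) (at t)" using u_deriv[OF t] by (simp add: damp_def)
  have "(w_corr has_real_derivative
      damp t + (a - damp t) * \<tau> t + (\<nu> * (a - damp t) * g t * \<tau> t * z t + (- damp t * (z t)\<^sup>2) * q t) - a) (at t)"
    unfolding w_corr_def[abs_def]
    by (intro DERIV_add DERIV_diff DERIV_mult u' h_deriv q_deriv z_deriv t DERIV_cmult_Id)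
  moreover have "damp t + (a - damp t) * \<tau> t + (\<nu> * (a - damp t) * g t * \<tau> t * z t + (- damp t * (z t)\<^sup>2) * q t) - a
     = - (\<nu>\<^sup>2 * (a - damp t) * (g t)\<^sup>2 + q t * damp t) * (z t)\<^sup>2"
    unfolding tau_eq by (simp add: power2_eq_square algebra_simps)
  ultimately show ?thesis by simp
qed

lemma A_corr_deriv:
  assumes t: "t \<ge> t0"
  shows "(A_corr has_real_derivative
      (\<nu>\<^sup>2 * (A t * g t * G t + B t * (g t)\<^sup>2) + \<nu> * (B t * G t * damp t)) * (z t)\<^sup>2) (at t)"
proof -
  have "(A_corr has_real_derivative
      \<nu> * g t * z t * B t - \<nu> * (- (\<nu> * g t * z t * A t) * (G t * z t)
        + (g t * \<tau> t * z t + (- damp t * (z t)\<^sup>2) * G t) * B t)) (at t)"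
    unfolding A_corr_def[abs_def]
    by (intro DERIV_add DERIV_diff DERIV_mult DERIV_cmult A_deriv B_deriv G_deriv z_deriv t)
  moreover have "\<nu> * g t * z t * B t - \<nu> * (- (\<nu> * g t * z t * A t) * (G t * z t)
        + (g t * \<tau> t * z t + (- damp t * (z t)\<^sup>2) * G t) * B t)
     = (\<nu>\<^sup>2 * (A t * g t * G t + B t * (g t)\<^sup>2) + \<nu> * (B t * G t * damp t)) * (z t)\<^sup>2"
    unfolding tau_eq by (simp add: power2_eq_square algebra_simps)
  ultimately show ?thesis by simp
qed

lemma B_corr_deriv:
  assumes t: "t \<ge> t0"
  shows "(B_corr has_real_derivative
      (\<nu>\<^sup>2 * (B t * g t * G t - A t * (g t)\<^sup>2) - \<nu> * (A t * G t * damp t)) * (z t)\<^sup>2) (at t)"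
proof -
  have "(B_corr has_real_derivative
      - (\<nu> * g t * z t * A t) + \<nu> * ((\<nu> * g t * z t * B t) * (G t * z t)
        + (g t * \<tau> t * z t + (- damp t * (z t)\<^sup>2) * G t) * A t)) (at t)"
    unfolding B_corr_def[abs_def]
    by (intro DERIV_add DERIV_diff DERIV_mult DERIV_cmult A_deriv B_deriv G_deriv z_deriv t)
  moreover have "- (\<nu> * g t * z t * A t) + \<nu> * ((\<nu> * g t * z t * B t) * (G t * z t)
        + (g t * \<tau> t * z t + (- damp t * (z t)\<^sup>2) * G t) * A t)
     = (\<nu>\<^sup>2 * (B t * g t * G t - A t * (g t)\<^sup>2) - \<nu> * (A t * G t * damp t)) * (z t)\<^sup>2"
    unfolding tau_eq by (simp add: power2_eq_square algebra_simps)
  ultimately show ?thesis by simp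
qed

section \<open>Bootstrapping the expansion\<close>

definition "r t = t / u t"
definition "w t = u t - a * t"

lemma expandable_derivative_z2:
  assumes "\<And>t. t \<ge> t0 \<Longrightarrow> (f has_real_derivative p t * (z t)\<^sup>2) (at t)"
    and "expandable N p" "expandable N r"
  shows "expandable (Suc N) f"
proof (rule expandable_antiderivative)
  show "expandable N (\<lambda>t. p t * (r t)\<^sup>2)" by (intro expandable_intros assms)
  show "\<forall>\<^sub>F t in at_top. (f has_real_derivative p t * (r t)\<^sup>2 / t\<^sup>2) (at t)"
    using eventually_ge_at_top[of t0]
  proof eventually_elim
    case (elim t)
    then have "p t * (z t)\<^sup>2 = p t * (r t)\<^sup>2 / t\<^sup>2"
      using t0 by (simp add: z_def r_def power_divide)
    with assms(1)[OF elim] show ?case by simp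
  qed
qed

lemma z_eq: "t > 0 \<Longrightarrow> z t = r t / t"
  by (simp add: z_def r_def)

lemma coefficients_expandable:
  assumes "expandable N C" "expandable N S"
  shows "expandable N g" "expandable N G" "expandable N damp" "expandable N h" "expandable N q"
proof -
  have G: "expandable N (\<lambda>t. S t ^ (k + 2) * (1 / real (k + 2)))"
    by (intro expandable_intros assms)
  then show G: "expandable N G" by (simp add: G_def[abs_def] del: expandable.simps)
  have "expandable N (\<lambda>t. \<nu> * (a * G t - real k * \<nu> * (S t ^ (2 * k + 4) * (1 / real (2 * k + 4)))))"
    by (intro expandable_intros assms G)
  then show "expandable N q" by (simp add: q_def[abs_def] del: expandable.simps)
qed (unfold g_def[abs_def] damp_def[abs_def] h_def[abs_def],
     (intro expandable_intros sin_power_primitive_expandable assms)+)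

text \<open>
  The linear lower bound on \<open>u\<close> makes the derivative of \<open>w_corr\<close> of order \<open>1 / t\<^sup>2\<close>, so \<open>w_corr\<close> is bounded, and with
  it the deviation \<open>w\<close> of \<open>u\<close> from linear growth.
\<close>

lemma expandable_0_base:
  shows "expandable 0 A" "expandable 0 B" "expandable 0 r" "expandable 0 w"
proof -
  obtain c where c: "c > 0" "\<forall>\<^sub>F t in at_top. c * t \<le> u t" by (rule linear_growth)
  from c(2) have "\<forall>\<^sub>F t in at_top. \<bar>r t\<bar> \<le> 1 / c"
    using eventually_ge_at_top[of t0]
  proof eventually_elim
    case (elim t)
    with c(1) t0 u_pos[of t] show ?case by (simp add: r_def field_simps)
  qed
  then show r: "expandable 0 r" by auto
  have "\<forall>\<^sub>F t in at_top. \<bar>C t\<bar> \<le> 1" "\<forall>\<^sub>F t in at_top. \<bar>S t\<bar> \<le> 1"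
    using C_le_1 S_le_1 by (auto simp: eventually_at_top_linorder)
  then have CS: "expandable 0 C" "expandable 0 S" by auto
  note sc = expandable_periodic[OF periodic_coeff_sin] expandable_periodic[OF periodic_coeff_cos]
  show AB: "expandable 0 A" "expandable 0 B"
    unfolding A_def[abs_def] B_def[abs_def] by (intro expandable_intros CS sc)+
  note co = coefficients_expandable[OF CS]
  have "expandable (Suc 0) w_corr"
    by (rule expandable_derivative_z2[OF w_corr_deriv]) (intro expandable_intros co r | assumption)+
  then have "expandable 0 w_corr" by (rule expandable_Suc_imp)
  then have "expandable 0 (\<lambda>t. w_corr t - h t - q t * r t / t)"
    by (intro expandable_intros co r expandable_div_same)
  moreover have "\<forall>\<^sub>F t in at_top. w t = w_corr t - h t - q t * r t / t"
    using eventually_gt_at_top[of 0] by eventually_elim (simp add: w_def w_corr_def z_eq)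
  ultimately show "expandable 0 w" by (rule expandable_cong[rotated])
qed

text \<open>
  The equation \<open>u = a t + w\<close> solved for \<open>r = t / u\<close> in fixed-point form: the right-hand side
  is expandable to one order more than \<open>w\<close> and \<open>r\<close>, which replaces the geometric series for \<open>1 / u\<close>.
\<close>

lemma r_eq: "t \<ge> t0 \<Longrightarrow> r t = 1 / a + (- (1 / a) * w t * r t) / t"
proof -
  assume "t \<ge> t0"
  then have "u t > 0" "t > 0" using u_pos t0 by auto
  with a_pos show ?thesis by (simp add: r_def w_def field_simps)
qed

lemma expandable_C_S:
  assumes "expandable N A" "expandable N B"
  shows "expandable N C" "expandable N S"
proof -
  note sc = expandable_periodic[OF periodic_coeff_sin] expandable_periodic[OF periodic_coeff_cos]
  show "expandable N C"
    by (rule expandable_cong[OF always_eventually]) (rule allI, rule C_eq, intro expandable_intros assms sc)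
  show "expandable N S"
    by (rule expandable_cong[OF always_eventually]) (rule allI, rule S_eq, intro expandable_intros assms sc)
qed

text \<open>
  The corrected variables gain an order by integration, and they differ from the original ones only by
  products carrying a factor \<open>1 / t\<close>, except for the term \<open>h\<close> in \<open>w\<close>.  As \<open>h\<close> depends on the phase alone,
  it has already gained its order once \<open>A\<close> and \<open>B\<close> have; hence \<open>w\<close> is treated after them.
\<close>

lemma expandable_step:
  assumes "expandable N A" "expandable N B" "expandable N r" "expandable N w"
  shows "expandable (Suc N) A" "expandable (Suc N) B" "expandable (Suc N) r" "expandable (Suc N) w"
proof -
  note co = coefficients_expandable[OF expandable_C_S[OF assms(1,2)]]
  note rr = assms(3)
  have corr: "expandable (Suc N) (\<lambda>t. x t * (y t * r t) / t)" if "expandable N x" "expandable N y" for x y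
    by (intro expandable_div expandable_mult that rr)
  have "expandable (Suc N) A_corr"
    by (rule expandable_derivative_z2[OF A_corr_deriv]) (intro expandable_intros assms co | assumption)+
  then have 1: "expandable (Suc N) (\<lambda>t. A_corr t + \<nu> * (B t * (G t * r t) / t))"
    by (intro expandable_intros corr assms co)
  have "expandable (Suc N) B_corr"
    by (rule expandable_derivative_z2[OF B_corr_deriv]) (intro expandable_intros assms co | assumption)+
  then have 2: "expandable (Suc N) (\<lambda>t. B_corr t - \<nu> * (A t * (G t * r t) / t))"
    by (intro expandable_intros corr assms co)
  have "\<forall>\<^sub>F t in at_top. A t = A_corr t + \<nu> * (B t * (G t * r t) / t)"
    using eventually_gt_at_top[of 0] by eventually_elim (simp add: A_corr_def z_eq)
  then show A: "expandable (Suc N) A" using 1 by (rule expandable_cong)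
  have "\<forall>\<^sub>F t in at_top. B t = B_corr t - \<nu> * (A t * (G t * r t) / t)"
    using eventually_gt_at_top[of 0] by eventually_elim (simp add: B_corr_def z_eq)
  then show B: "expandable (Suc N) B" using 2 by (rule expandable_cong)
  have h': "expandable (Suc N) h" by (rule coefficients_expandable[OF expandable_C_S[OF A B]])
  have "expandable (Suc N) w_corr"
    by (rule expandable_derivative_z2[OF w_corr_deriv]) (intro expandable_intros co rr | assumption)+
  then have 3: "expandable (Suc N) (\<lambda>t. w_corr t - h t - q t * r t / t)"
    by (intro expandable_diff h' expandable_div expandable_mult co rr)
  have "\<forall>\<^sub>F t in at_top. w t = w_corr t - h t - q t * r t / t"
    using eventually_gt_at_top[of 0] by eventually_elim (simp add: w_def w_corr_def z_eq)
  then show "expandable (Suc N) w" using 3 by (rule expandable_cong)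
  have "\<forall>\<^sub>F t in at_top. r t = 1 / a + (- (1 / a) * w t * r t) / t"
    using eventually_ge_at_top[of t0] by eventually_elim (rule r_eq)
  moreover have "expandable (Suc N) (\<lambda>t. 1 / a + (- (1 / a) * w t * r t) / t)"
    by (intro expandable_add expandable_const expandable_div expandable_mult assms)
  ultimately show "expandable (Suc N) r" by (rule expandable_cong)
qed

lemma expandable_all: "expandable N A" "expandable N B" "expandable N r" "expandable N w"
proof -
  have "expandable N A \<and> expandable N B \<and> expandable N r \<and> expandable N w"
  proof (induction N)
    case 0
    show ?case by (intro conjI expandable_0_base)
  next
    case (Suc N)
    then show ?case by (elim conjE) (intro conjI expandable_step)
  qed
  then show "expandable N A" "expandable N B" "expandable N r" "expandable N w" by simp_all
qed

lemma expandable_S: "expandable N S"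
  by (rule expandable_C_S[OF expandable_all(1,2)])

lemma expandable_amplitude:
  assumes "\<forall>\<^sub>F t in at_top. y t > 0 \<and> y t ^ k = t / u t"
  shows "expandable N y"
proof (rule expandable_root)
  show "\<forall>\<^sub>F t in at_top. y t > 0 \<and> y t ^ k = 1 / a + (- (1 / a) * w t * r t) / t"
    using assms eventually_ge_at_top[of t0]
  proof eventually_elim
    case (elim t)
    then show ?case unfolding r_eq[OF elim(2), symmetric] by (simp add: r_def)
  qed
  show "expandable N (\<lambda>t. - (1 / a) * w t * r t)" for N
    by (intro expandable_mult expandable_const expandable_all)
qed (use k m a_pos in auto)

end

section \<open>From the partial differential equations to the oscillator\<close>

text \<open>
  Only the open half plane is considered: on the line \<open>t = 0\<close> the time derivative is one-sided, and the
  behaviour for large \<open>t\<close> does not depend on it.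
\<close>

lemma has_real_derivative_along_curve:
  assumes U: "has_C1_partials U Ux Ut" and t: "t > 0"
    and X: "(X has_real_derivative v) (at t)"
  shows "((\<lambda>t. U (X t) t) has_real_derivative Ux (X t) t * v + Ut (X t) t) (at t)"
proof -
  have fx: "((\<lambda>x. U x t) has_derivative (\<lambda>d. Ux (X t) t * d)) (at (X t) within UNIV)"
    using U t by (simp add: has_C1_partials_def has_field_derivative_def)
  have fy: "((\<lambda>s. U x s) has_derivative blinfun_apply (blinfun_mult_right (Ut x s))) (at s within {0<..})"
    if "s \<in> {0<..}" for x s
  proof -
    have "((\<lambda>s. U x s) has_real_derivative Ut x s) (at s within {0..})"
      using U that by (simp add: has_C1_partials_def)
    then have "((\<lambda>s. U x s) has_real_derivative Ut x s) (at s within {0<..})"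
      by (rule DERIV_subset) auto
    then show ?thesis by (simp add: has_field_derivative_def)
  qed
  have "continuous_on (UNIV \<times> {0<..}) (\<lambda>(x, t). Ut x t)"
    using U by (auto simp: has_C1_partials_def intro: continuous_on_subset)
  then have "continuous_on (UNIV \<times> {0<..}) (\<lambda>p. blinfun_mult_right (case p of (x, t) \<Rightarrow> Ut x t))"
    by (intro bounded_linear.continuous_on[OF bounded_linear_blinfun_mult_right])
  then have cont: "continuous (at (X t, t) within UNIV \<times> {0<..}) (\<lambda>(x, s). blinfun_mult_right (Ut x s))"
    using t by (simp add: continuous_on_eq_continuous_within case_prod_unfold)
  have "((\<lambda>(x, s). U x s) has_derivative
      (\<lambda>(dx, ds). Ux (X t) t * dx + blinfun_apply (blinfun_mult_right (Ut (X t) t)) ds))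
      (at (X t, t) within UNIV \<times> {0<..})"
    by (rule has_derivative_partialsI[OF fx fy cont]) (use t in auto)
  moreover have "open (UNIV \<times> {0::real<..} :: (real \<times> real) set)"
    by (intro open_Times) auto
  ultimately have dU: "((\<lambda>(x, s). U x s) has_derivative
      (\<lambda>(dx, ds). Ux (X t) t * dx + Ut (X t) t * ds)) (at (X t, t))"
    using t by (subst (asm) at_within_open) (auto simp: case_prod_unfold)
  have dX: "((\<lambda>s. (X s, s)) has_derivative (\<lambda>d. (v * d, d))) (at t)"
    using X by (intro has_derivative_Pair) (auto simp: has_field_derivative_def)
  have "((\<lambda>s. case (X s, s) of (x, s) \<Rightarrow> U x s) has_derivative
      (\<lambda>d. case (v * d, d) of (dx, ds) \<Rightarrow> Ux (X t) t * dx + Ut (X t) t * ds)) (at t)"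
    using has_derivative_compose[OF dX dU] .
  moreover have "(\<lambda>d. case (v * d, d) of (dx, ds) \<Rightarrow> Ux (X t) t * dx + Ut (X t) t * ds)
      = (*) (Ux (X t) t * v + Ut (X t) t)"
    by (auto simp: fun_eq_iff algebra_simps)
  ultimately show ?thesis by (simp add: has_field_derivative_def)
qed

text \<open>
  The squared amplitude \<open>\<rho> = E\<^sup>2 + V\<^sup>2\<close> decreases.  If it vanishes once, then \<open>V\<close> vanishes from then on and its expansion is
  trivial; otherwise polar coordinates are available at all positive times.  Since
  \<open>u = R\<^sup>-\<^sup>k\<close>, the rescaled amplitude \<open>y = t\<^sup>1\<^sup>/\<^sup>k R\<close> is a \<open>k\<close>-th root of \<open>t / u\<close>, and
  \<open>V = - R S\<close>.
\<close>

lemma damped_oscillator_expandable: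
  fixes V E :: "real \<Rightarrow> real"
  assumes nu: "\<nu> > 0" and m: "m \<ge> 1" and k: "k = 2 * m"
    and V: "\<And>t. t > 0 \<Longrightarrow> (V has_real_derivative - E t - \<nu> * V t ^ (k + 1)) (at t)"
    and E: "\<And>t. t > 0 \<Longrightarrow> (E has_real_derivative V t) (at t)"
  shows "\<exists>g. (\<forall>N. expandable N g) \<and> (\<forall>t>0. V t = t powr (- 1 / real k) * g t)"
proof -
  define \<rho> where "\<rho> = (\<lambda>t. (E t)\<^sup>2 + (V t)\<^sup>2)"
  have \<rho>': "(\<rho> has_real_derivative - 2 * \<nu> * V t ^ (k + 2)) (at t)" if "t > 0" for t
    unfolding \<rho>_def
    by (auto intro!: derivative_eq_intros E V that simp: power2_eq_square algebra_simps)
  have even_power: "V t ^ (k + 2) \<ge> 0" for t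
  proof -
    have "even (k + 2)" by (simp add: k)
    then show ?thesis by (rule zero_le_even_power)
  qed
  have \<rho>_mono: "\<rho> t \<le> \<rho> s" if "0 < s" "s \<le> t" for s t
  proof (rule DERIV_nonpos_imp_nonincreasing[OF that(2)])
    fix x assume "s \<le> x" "x \<le> t"
    then show "\<exists>y. (\<rho> has_real_derivative y) (at x) \<and> y \<le> 0"
      using \<rho>'[of x] that nu even_power[of x] by (intro exI conjI) auto
  qed
  show ?thesis
  proof (cases "\<exists>t1>0. \<rho> t1 = 0")
    case True
    then obtain t1 where t1: "t1 > 0" "\<rho> t1 = 0" by auto
    have "V t = 0" if "t \<ge> t1" for t
    proof -
      have "\<rho> t \<le> 0" using \<rho>_mono[of t1 t] t1 that by simp
      then show ?thesis by (simp add: \<rho>_def sum_power2_le_zero_iff)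
    qed
    then have "\<forall>\<^sub>F t in at_top. t powr (1 / real k) * V t = 0"
      by (auto simp: eventually_at_top_linorder)
    then have "expandable N (\<lambda>t. t powr (1 / real k) * V t)" for N
      by (rule expandable_cong[OF _ expandable_0])
    then show ?thesis
      by (intro exI[of _ "\<lambda>t. t powr (1 / real k) * V t"]) (auto simp: powr_minus)
  next
    case False
    have \<rho>_pos: "\<rho> t > 0" if "t > 0" for t
    proof -
      have "\<rho> t \<ge> 0" by (simp add: \<rho>_def)
      with False that show ?thesis by force
    qed
    define R where "R = (\<lambda>t. sqrt (\<rho> t))"
    have R: "R t > 0" "(R t)\<^sup>2 = \<rho> t" if "t > 0" for t using \<rho>_pos[OF that] by (auto simp: R_def)
    have R': "(R has_real_derivative - \<nu> * V t ^ (k + 2) / R t) (at t)" if "t > 0" for t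
    proof -
      have "(R has_real_derivative (inverse (R t) / 2) * (- 2 * \<nu> * V t ^ (k + 2))) (at t)"
        unfolding R_def by (rule DERIV_chain2[OF DERIV_real_sqrt[OF \<rho>_pos[OF that]] \<rho>'[OF that]])
      also have "(inverse (R t) / 2) * (- 2 * \<nu> * V t ^ (k + 2)) = - \<nu> * V t ^ (k + 2) / R t"
        by (simp only: divide_inverse mult_ac) simp
      finally show ?thesis .
    qed
    define C where "C = (\<lambda>t. E t / R t)"
    define S where "S = (\<lambda>t. - V t / R t)"
    define u where "u = (\<lambda>t. 1 / R t ^ k)"
    interpret slow_fast_system \<nu> k m u C S 1
    proof
      fix t :: real assume "1 \<le> t"
      then have t: "t > 0" by simp
      have EV: "E t = C t * R t" "V t = - (S t * R t)"
        using R(1)[OF t] by (auto simp: C_def S_def)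
      have 1: "(C t)\<^sup>2 + (S t)\<^sup>2 = 1"
      proof -
        have "(C t)\<^sup>2 + (S t)\<^sup>2 = \<rho> t / (R t)\<^sup>2"
          by (simp add: C_def S_def \<rho>_def power_divide add_divide_distrib)
        then show ?thesis using R(2)[OF t] \<rho>_pos[OF t] by simp
      qed
      show "(C t)\<^sup>2 + (S t)\<^sup>2 = 1" by (rule 1)
      have C2: "C t * C t = 1 - S t * S t" using 1 by (simp add: power2_eq_square algebra_simps)
      show "u t > 0" using R(1)[OF t] by (simp add: u_def)
      have ev: "(- x) ^ k = x ^ k" for x :: real by (simp add: k)
      have Vk: "V t ^ k = S t ^ k * R t ^ k" by (simp add: EV(2) ev power_mult_distrib)
      have Rpos: "R t > 0" by (rule R(1)[OF t])
      have Rd: "(R has_real_derivative - \<nu> * S t ^ (k + 2) * R t ^ k * R t) (at t)"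
      proof -
        have "- \<nu> * V t ^ (k + 2) / R t = - \<nu> * (V t ^ k * V t * V t) / R t" by simp
        also have "\<dots> = - \<nu> * S t ^ (k + 2) * R t ^ k * R t"
          unfolding Vk unfolding EV(2) using Rpos by (simp add: mult_ac)
        finally show ?thesis using R'[OF t] by simp
      qed
      have Vd: "(V has_real_derivative - (C t * R t) + \<nu> * (S t ^ (k + 1) * R t ^ k * R t)) (at t)"
      proof -
        have "- E t - \<nu> * V t ^ (k + 1) = - E t - \<nu> * (V t ^ k * V t)" by simp
        also have "\<dots> = - (C t * R t) + \<nu> * (S t ^ (k + 1) * R t ^ k * R t)"
          unfolding Vk unfolding EV by (simp add: mult_ac)
        finally show ?thesis using V[OF t] by simp
      qed
      show "(u has_real_derivative real k * \<nu> * S t ^ (k + 2)) (at t)"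
      proof -
        have "k > 0" using k m by simp
        then obtain j where j: "k = Suc j" by (cases k) auto
        define D where "D = (1 + real j) * ((- \<nu> * S t ^ (k + 2) * R t ^ k * R t) * R t ^ j)"
        have "((\<lambda>t. R t ^ Suc j) has_real_derivative D) (at t)"
          unfolding D_def by (rule DERIV_power_Suc[OF Rd])
        then have "((\<lambda>t. 1 / R t ^ Suc j) has_real_derivative
            (0 * R t ^ Suc j - 1 * D) / (R t ^ Suc j * R t ^ Suc j)) (at t)"
          using Rpos by (intro DERIV_divide DERIV_const) auto
        moreover have "(0 * R t ^ Suc j - 1 * D) / (R t ^ Suc j * R t ^ Suc j)
            = real k * \<nu> * S t ^ (k + 2)"
          using Rpos by (simp add: D_def j)
        ultimately show ?thesis unfolding u_def j by simp
      qed
      show "(C has_real_derivative - S t * (1 - \<nu> * (C t * S t ^ (k + 1)) * (1 / u t))) (at t)"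
      proof -
        have "(C has_real_derivative (V t * R t - E t * (- \<nu> * S t ^ (k + 2) * R t ^ k * R t)) / (R t * R t)) (at t)"
          unfolding C_def using Rpos by (intro DERIV_divide E t Rd) auto
        moreover have "(V t * R t - E t * (- \<nu> * S t ^ (k + 2) * R t ^ k * R t)) / (R t * R t)
           = - S t * (1 - \<nu> * (C t * S t ^ (k + 1)) * (1 / u t))"
          unfolding EV using Rpos by (simp add: u_def field_simps)
        ultimately show ?thesis by simp
      qed
      show "(S has_real_derivative C t * (1 - \<nu> * (C t * S t ^ (k + 1)) * (1 / u t))) (at t)"
      proof -
        have "(S has_real_derivative (- (- (C t * R t) + \<nu> * (S t ^ (k + 1) * R t ^ k * R t)) * R t
             - (- V t) * (- \<nu> * S t ^ (k + 2) * R t ^ k * R t)) / (R t * R t)) (at t)"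
          using DERIV_divide[OF DERIV_minus[OF Vd] Rd] Rpos by (simp only: S_def)
        moreover have "(- (- (C t * R t) + \<nu> * (S t ^ (k + 1) * R t ^ k * R t)) * R t
             - (- V t) * (- \<nu> * S t ^ (k + 2) * R t ^ k * R t)) / (R t * R t)
          = C t - \<nu> * S t ^ (k + 1) * R t ^ k * (1 - S t * S t)"
          unfolding EV using Rpos by (simp add: field_simps)
        moreover have "C t - \<nu> * S t ^ (k + 1) * R t ^ k * (1 - S t * S t)
           = C t * (1 - \<nu> * (C t * S t ^ (k + 1)) * (1 / u t))"
          unfolding C2[symmetric] by (simp add: u_def algebra_simps)
        ultimately show ?thesis by simp
      qed
    qed (use nu m k in auto)
    define y where "y = (\<lambda>t. t powr (1 / real k) * R t)"
    have "\<forall>\<^sub>F t in at_top. y t > 0 \<and> y t ^ k = t / u t"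
      using eventually_gt_at_top[of 0]
    proof eventually_elim
      case (elim t)
      have "(t powr (1 / real k)) ^ k = t"
        using elim k m by (simp add: powr_power)
      with elim R(1)[OF elim] show ?case by (simp add: y_def u_def power_mult_distrib)
    qed
    then have y: "expandable N y" for N by (rule expandable_amplitude)
    have "V t = t powr (- 1 / real k) * (- (y t * S t))" if "t > 0" for t
    proof -
      have "t powr (- 1 / real k) * t powr (1 / real k) = 1" using that by (simp flip: powr_add)
      moreover have "t powr (- 1 / real k) * (- (y t * S t))
          = (t powr (- 1 / real k) * t powr (1 / real k)) * (- (R t * S t))"
        by (simp add: y_def)
      moreover have "- (R t * S t) = V t" using R(1)[OF that] by (simp add: S_def)
      ultimately show ?thesis by simp
    qed
    moreover have "expandable N (\<lambda>t. - (y t * S t))" for N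
      by (intro expandable_minus expandable_mult y expandable_S)
    ultimately show ?thesis by (intro exI[of _ "\<lambda>t. - (y t * S t)"]) blast
  qed
qed

theorem theorem1:
  fixes \<nu>0 :: real and \<nu> :: "real \<Rightarrow> real" and k m :: nat
    and V0 E0 :: "real \<Rightarrow> real" and V E :: "real \<Rightarrow> real \<Rightarrow> real"
    and x0 :: real and X :: "real \<Rightarrow> real"
  assumes "\<nu>0 > 0" and "m \<ge> 1" and "k = 2 * m"
    and "\<And>s. s \<ge> 0 \<Longrightarrow> \<nu> s = \<nu>0 * s ^ k"
    and "C2_on_real V0" and "C2_on_real E0"
    and "\<And>x. deriv E0 x < 1"
    and "global_smooth_solution \<nu> V0 E0 V E"
    and "characteristic V x0 X"
  shows "\<exists>\<Psi> :: nat \<Rightarrow> real \<Rightarrow> real.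
           (\<forall>n. periodic_real (\<Psi> n)) \<and>
           asymp_expansion (\<lambda>t. V (X t) t) (- 1 / real k) \<Psi>"
proof -
  obtain Vx Vt Ex Et where C1: "has_C1_partials V Vx Vt" "has_C1_partials E Ex Et"
    and eqs: "\<And>x t. t \<ge> 0 \<Longrightarrow> Vt x t + V x t * Vx x t = - E x t - \<nu> \<bar>V x t\<bar> * V x t"
      "\<And>x t. t \<ge> 0 \<Longrightarrow> Et x t + V x t * Ex x t - V x t = 0"
    using assms(8) unfolding global_smooth_solution_def by blast
  have X: "(X has_real_derivative V (X t) t) (at t)" if "t > 0" for t
  proof -
    have "(X has_real_derivative V (X t) t) (at t within {0..})"
      using assms(9) that by (simp add: characteristic_def)
    then have "(X has_real_derivative V (X t) t) (at t within {0<..})"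
      by (rule DERIV_subset) auto
    then show ?thesis using that by (simp add: at_within_open[of t "{0<..}"])
  qed
  have "even k" using assms(3) by simp
  have "\<exists>g. (\<forall>N. expandable N g) \<and> (\<forall>t>0. V (X t) t = t powr (- 1 / real k) * g t)"
  proof (rule damped_oscillator_expandable[of \<nu>0 m k "\<lambda>t. V (X t) t" "\<lambda>t. E (X t) t"])
    fix t :: real assume t: "t > 0"
    have "Vx (X t) t * V (X t) t + Vt (X t) t = - E (X t) t - \<nu>0 * V (X t) t ^ (k + 1)"
      using eqs(1)[of t "X t"] t assms(4)[of "\<bar>V (X t) t\<bar>"] \<open>even k\<close>
      by (simp add: power_even_abs mult_ac)
    then show "((\<lambda>t. V (X t) t) has_real_derivative - E (X t) t - \<nu>0 * V (X t) t ^ (k + 1)) (at t)"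
      using has_real_derivative_along_curve[OF C1(1) t X[OF t]] by simp
    have "Ex (X t) t * V (X t) t + Et (X t) t = V (X t) t"
      using eqs(2)[of t "X t"] t by (simp add: mult_ac)
    then show "((\<lambda>t. E (X t) t) has_real_derivative V (X t) t) (at t)"
      using has_real_derivative_along_curve[OF C1(2) t X[OF t]] by simp
  qed (use assms(1-3) in auto)
  then obtain g where g: "\<And>N. expandable N g" "\<And>t. t > 0 \<Longrightarrow> V (X t) t = t powr (- 1 / real k) * g t"
    by blast
  obtain \<Psi> where \<Psi>: "\<forall>n. periodic_real (\<Psi> n)"
    "asymp_expansion (\<lambda>t. t powr (- 1 / real k) * g t) (- 1 / real k) \<Psi>"
    using expandable_all_imp_asymp_expansion[OF g(1)] by blast
  have "asymp_expansion (\<lambda>t. V (X t) t) (- 1 / real k) \<Psi>"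
    unfolding asymp_expansion_def
  proof
    fix N
    have "\<forall>\<^sub>F t in at_top. V (X t) t - t powr (- 1 / real k) * (\<Sum>n=0..N. \<Psi> n t * t powr (- real n))
       = t powr (- 1 / real k) * g t - t powr (- 1 / real k) * (\<Sum>n=0..N. \<Psi> n t * t powr (- real n))"
      using eventually_gt_at_top[of 0] by eventually_elim (simp add: g(2))
    from landau_o.small.in_cong[OF this] \<Psi>(2)
    show "(\<lambda>t. V (X t) t - t powr (- 1 / real k) * (\<Sum>n=0..N. \<Psi> n t * t powr (- real n)))
        \<in> o[at_top](\<lambda>t. t powr (- 1 / real k - real N))"
      unfolding asymp_expansion_def by blast
  qed
  with \<Psi>(1) show ?thesis by blast
qed

end
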